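(* Let $V=\{V(n)\}_{n=1}^\infty$ be a sequence of real numbers, let $H$ be the half-line discrete Schr\"odinger operator with potential $V$ and Dirichlet boundary condition, let $\mu$ be its spectral measure associated to $\delta_1$, and let $F(z)=\int_{\mathbb{R}}\frac{d\mu(x)}{x-z}$. Let $E\in\mathbb{R}$ and let $u_1,u_2$ be the solutions of $u(n-1)+u(n+1)+V(n)u(n)=Eu(n)$ ($n\ge1$) with $u_1(0)=0$, $u_1(1)=1$, $u_2(0)=1$, $u_2(1)=0$. Let $\rho$ be a Hausdorff dimension function. Then $$\limsup_{\epsilon\to0^+}\frac{\epsilon}{\rho(\epsilon)}\,|F(E+i\epsilon)|=\infty$$ if and only if $$\liminf_{L\to\infty}\rho\big(\|u_1\|_L^{-1}\|u_2\|_L^{-1}\big)\,\|u_1\|_L^2=0 .$$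
   Context: The operator $H$ acts on $\ell^2(\mathbb{Z}^+)$, $\mathbb{Z}^+=\{1,2,\dots\}$, by $(H\psi)(n)=\psi(n-1)+\psi(n+1)+V(n)\psi(n)$ with $\psi(0)=0$ (self-adjoint on its maximal domain); $\delta_1$ is a cyclic vector. For $L>0$, $\|u\|_L=\Big(\sum_{n=1}^{\lfloor L\rfloor}|u(n)|^2+(L-\lfloor L\rfloor)|u(\lfloor L\rfloor+1)|^2\Big)^{1/2}$. A Hausdorff dimension function (also called Hausdorff measure function or gauge function) is a strictly increasing differentiable function $\rho:(0,\infty)\to(0,\infty)$ with $\lim_{t\to0^+}\rho(t)=0$. *)

theory Defs
  imports "HOL-Analysis.Analysis"
begin

text \<open>
  The Hilbert space of square-summable sequences on the positive integers. A sequence is a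
  function on nat whose entry 0 is the boundary value, so the Dirichlet condition is part of
  the space.
\<close>

definition ell2 :: "(nat \<Rightarrow> complex) set" where
  "ell2 = {\<psi>. \<psi> 0 = 0 \<and> summable (\<lambda>n. (cmod (\<psi> n))\<^sup>2)}"

definition ell2_inner :: "(nat \<Rightarrow> complex) \<Rightarrow> (nat \<Rightarrow> complex) \<Rightarrow> complex" where
  "ell2_inner \<phi> \<psi> = (\<Sum>n. cnj (\<phi> n) * \<psi> n)"

definition ell2_norm :: "(nat \<Rightarrow> complex) \<Rightarrow> real" where
  "ell2_norm \<psi> = sqrt (\<Sum>n. (cmod (\<psi> n))\<^sup>2)"

definition delta1 :: "nat \<Rightarrow> complex" where
  "delta1 n = (if n = 1 then 1 else 0)"

definition schroedinger :: "(nat \<Rightarrow> real) \<Rightarrow> (nat \<Rightarrow> complex) \<Rightarrow> nat \<Rightarrow> complex" where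
  "schroedinger V \<psi> n =
     (if n = 0 then 0 else \<psi> (n - 1) + \<psi> (n + 1) + of_real (V n) * \<psi> n)"

definition schroedinger_domain :: "(nat \<Rightarrow> real) \<Rightarrow> (nat \<Rightarrow> complex) set" where
  "schroedinger_domain V = {\<psi> \<in> ell2. schroedinger V \<psi> \<in> ell2}"

definition ell2_projection :: "((nat \<Rightarrow> complex) \<Rightarrow> (nat \<Rightarrow> complex)) \<Rightarrow> bool" where
  "ell2_projection P \<longleftrightarrow>
     (\<forall>\<psi>\<in>ell2. P \<psi> \<in> ell2) \<and>
     (\<forall>\<phi>\<in>ell2. \<forall>\<psi>\<in>ell2. \<forall>a b.
        P (\<lambda>n. a * \<phi> n + b * \<psi> n) = (\<lambda>n. a * P \<phi> n + b * P \<psi> n)) \<and>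
     (\<forall>\<psi>\<in>ell2. P (P \<psi>) = P \<psi>) \<and>
     (\<forall>\<phi>\<in>ell2. \<forall>\<psi>\<in>ell2. ell2_inner \<phi> (P \<psi>) = ell2_inner (P \<phi>) \<psi>)"

text \<open>Projection-valued measures on the Borel sets of the line; countable additivity is in the
  strong operator topology.\<close>

definition projection_valued_measure ::
    "(real set \<Rightarrow> (nat \<Rightarrow> complex) \<Rightarrow> (nat \<Rightarrow> complex)) \<Rightarrow> bool" where
  "projection_valued_measure P \<longleftrightarrow>
     (\<forall>A\<in>sets borel. ell2_projection (P A)) \<and>
     (\<forall>\<psi>\<in>ell2. P {} \<psi> = (\<lambda>n. 0)) \<and>
     (\<forall>\<psi>\<in>ell2. P UNIV \<psi> = \<psi>) \<and>
     (\<forall>A\<in>sets borel. \<forall>B\<in>sets borel. \<forall>\<psi>\<in>ell2. P A (P B \<psi>) = P (A \<inter> B) \<psi>) \<and>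
     (\<forall>A :: nat \<Rightarrow> real set. range A \<subseteq> sets borel \<longrightarrow> disjoint_family A \<longrightarrow>
        (\<forall>\<psi>\<in>ell2. (\<lambda>N. ell2_norm (\<lambda>n. P (\<Union>i. A i) \<psi> n - (\<Sum>i<N. P (A i) \<psi> n)))
           \<longlonglongrightarrow> 0))"

definition scalar_measure ::
    "(real set \<Rightarrow> (nat \<Rightarrow> complex) \<Rightarrow> (nat \<Rightarrow> complex)) \<Rightarrow> (nat \<Rightarrow> complex) \<Rightarrow> real measure" where
  "scalar_measure P \<psi> =
     measure_of UNIV (sets borel) (\<lambda>A. ennreal (Re (ell2_inner \<psi> (P A \<psi>))))"

text \<open>
  The linear operator T with domain D is the integral of x against P: D consists of the vectors
  with finite second moment, and T is given by its quadratic form (which determines it by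
  polarization).
\<close>

definition spectral_resolution ::
    "((nat \<Rightarrow> complex) \<Rightarrow> (nat \<Rightarrow> complex)) \<Rightarrow> (nat \<Rightarrow> complex) set \<Rightarrow>
     (real set \<Rightarrow> (nat \<Rightarrow> complex) \<Rightarrow> (nat \<Rightarrow> complex)) \<Rightarrow> bool" where
  "spectral_resolution T D P \<longleftrightarrow>
     projection_valued_measure P \<and>
     D = {\<psi> \<in> ell2. integrable (scalar_measure P \<psi>) (\<lambda>x. x\<^sup>2)} \<and>
     (\<forall>\<psi>\<in>D. ell2_inner \<psi> (T \<psi>) = of_real (LINT x|scalar_measure P \<psi>. x))"

definition is_spectral_measure ::
    "((nat \<Rightarrow> complex) \<Rightarrow> (nat \<Rightarrow> complex)) \<Rightarrow> (nat \<Rightarrow> complex) set \<Rightarrow>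
     (nat \<Rightarrow> complex) \<Rightarrow> real measure \<Rightarrow> bool" where
  "is_spectral_measure T D \<psi> \<mu> \<longleftrightarrow>
     (\<exists>P. spectral_resolution T D P \<and> \<mu> = scalar_measure P \<psi>)"

definition borel_transform :: "real measure \<Rightarrow> complex \<Rightarrow> complex" where
  "borel_transform \<mu> z = (LINT x|\<mu>. 1 / (complex_of_real x - z))"

definition eigen_equation :: "(nat \<Rightarrow> real) \<Rightarrow> real \<Rightarrow> (nat \<Rightarrow> real) \<Rightarrow> bool" where
  "eigen_equation V E u \<longleftrightarrow> (\<forall>n\<ge>1. u (n - 1) + u (n + 1) + V n * u n = E * u n)"

definition norm_upto :: "(nat \<Rightarrow> real) \<Rightarrow> real \<Rightarrow> real" where
  "norm_upto u L =
     sqrt ((\<Sum>n = 1..nat \<lfloor>L\<rfloor>. \<bar>u n\<bar>\<^sup>2) + (L - of_int \<lfloor>L\<rfloor>) * \<bar>u (nat \<lfloor>L\<rfloor> + 1)\<bar>\<^sup>2)"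

text \<open>Only the values of the function on the positive half-line are constrained (or used).\<close>

definition hausdorff_dimension_function :: "(real \<Rightarrow> real) \<Rightarrow> bool" where
  "hausdorff_dimension_function \<rho> \<longleftrightarrow>
     (\<forall>t>0. \<rho> t > 0) \<and>
     strict_mono_on {0<..} \<rho> \<and>
     (\<forall>t>0. \<rho> differentiable (at t)) \<and>
     (\<rho> \<longlongrightarrow> 0) (at_right 0)"

end

theory Submission
  imports Defs
begin

text \<open>
  Write \<open>m = F (E + \<i> \<epsilon>)\<close>. The Weyl solution, the sequence \<open>w\<close> with \<open>w 0 = - 1\<close> and \<open>w 1 = m\<close> that solves
  the eigenvalue equation at \<open>E + \<i> \<epsilon>\<close>, is the resolvent applied to the first unit vector; it
  satisfies \<open>\<epsilon> \<parallel>w\<parallel>\<^sup>2 \<le> Im m\<close>. Comparing it, by variation of parameters, with the solution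
  \<open>m u1 - u2\<close> at the real energy \<open>E\<close> that has the same initial data gives

  \<open>\<parallel>m u1 - u2\<parallel>_L \<le> (1 + 2 \<epsilon> \<parallel>u1\<parallel>_L \<parallel>u2\<parallel>_L) \<parallel>w\<parallel>_L\<close>.

  At the scale \<open>\<epsilon> \<parallel>u1\<parallel>_L \<parallel>u2\<parallel>_L = 1\<close> the square of the right-hand side is at most
  \<open>9 \<bar>m\<bar> \<parallel>u1\<parallel>_L \<parallel>u2\<parallel>_L\<close>, and the triangle inequality bounds the ratio of \<open>\<bar>m\<bar> \<parallel>u1\<parallel>_L\<close> and
  \<open>\<parallel>u2\<parallel>_L\<close> by 11 from above and by 1/11 from below. This is the
  Jitomirskaya--Last inequality, \<open>Jitomirskaya_Last\<close>. Hence, with \<open>\<epsilon>\<close> and \<open>L\<close> so related,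
  \<open>\<epsilon> \<bar>m\<bar> / \<rho> \<epsilon>\<close> and \<open>\<rho> \<epsilon> \<parallel>u1\<parallel>_L\<^sup>2\<close> are inverse to each other up to a factor 11: one is
  arbitrarily large exactly when the other is arbitrarily small. As \<open>L\<close> grows, \<open>\<epsilon>\<close> tends
  to 0 continuously and so takes all small positive values, since the constancy of the
  Wronskian forces \<open>\<parallel>u1\<parallel>_L \<parallel>u2\<parallel>_L\<close> to infinity; so the upper limit in \<open>\<epsilon>\<close> corresponds
  to the lower limit in \<open>L\<close>.

  The spectral measure enters through \<open>weyl_solution\<close>. A spectral resolution is given here by its
  quadratic form only, and the resolvent is replaced by finite sums over a fine mesh of spectral
  projections. That these are approximate solutions follows from two consequences of
  polarization: the form of \<open>H\<close> vanishes between orthogonal spectral subspaces, and on the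
  subspace of a short interval it is nearly a multiple of the inner product
  (\<open>H_localized_bound\<close>).
\<close>

section \<open>Square-summable sequences\<close>

lemma ell2_summable: "\<psi> \<in> ell2 \<Longrightarrow> summable (\<lambda>n. (cmod (\<psi> n))\<^sup>2)"
  by (simp add: ell2_def)

lemma ell2_zero: "\<psi> \<in> ell2 \<Longrightarrow> \<psi> 0 = 0"
  by (simp add: ell2_def)

lemma cmod_add_square_le: "(cmod (x + y))\<^sup>2 \<le> 2 * (cmod x)\<^sup>2 + 2 * (cmod y)\<^sup>2"
proof -
  have "(cmod (x + y))\<^sup>2 \<le> (cmod x + cmod y)\<^sup>2"
    by (intro power_mono norm_triangle_ineq) simp
  also have "\<dots> \<le> 2 * (cmod x)\<^sup>2 + 2 * (cmod y)\<^sup>2"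
    using sum_squares_bound[of "cmod x" "cmod y"] by (simp add: power2_sum)
  finally show ?thesis .
qed

lemma ell2_lincomb:
  assumes "\<phi> \<in> ell2" "\<psi> \<in> ell2"
  shows "(\<lambda>n. a * \<phi> n + b * \<psi> n) \<in> ell2"
proof -
  have "summable (\<lambda>n. 2 * (cmod a)\<^sup>2 * (cmod (\<phi> n))\<^sup>2 + 2 * (cmod b)\<^sup>2 * (cmod (\<psi> n))\<^sup>2)"
    using assms by (intro summable_add summable_mult ell2_summable)
  then have "summable (\<lambda>n. (cmod (a * \<phi> n + b * \<psi> n))\<^sup>2)"
  proof (rule summable_comparison_test'[where N = 0])
    fix n :: nat
    show "norm ((cmod (a * \<phi> n + b * \<psi> n))\<^sup>2)
        \<le> 2 * (cmod a)\<^sup>2 * (cmod (\<phi> n))\<^sup>2 + 2 * (cmod b)\<^sup>2 * (cmod (\<psi> n))\<^sup>2"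
      using cmod_add_square_le[of "a * \<phi> n" "b * \<psi> n"]
      by (simp add: norm_mult power_mult_distrib mult.assoc)
  qed
  then show ?thesis
    using assms by (simp add: ell2_def)
qed

lemma ell2_diff: "\<phi> \<in> ell2 \<Longrightarrow> \<psi> \<in> ell2 \<Longrightarrow> (\<lambda>n. \<phi> n - \<psi> n) \<in> ell2"
  using ell2_lincomb[of \<phi> \<psi> 1 "-1"] by simp

lemma ell2_sum:
  assumes "finite J" "\<And>j. j \<in> J \<Longrightarrow> p j \<in> ell2"
  shows "(\<lambda>n. \<Sum>j\<in>J. b j * p j n) \<in> ell2"
  using assms
proof (induction J rule: finite_induct)
  case empty
  then show ?case by (simp add: ell2_def)
next
  case (insert i J)
  then show ?case
    using ell2_lincomb[of "p i" "\<lambda>n. \<Sum>j\<in>J. b j * p j n" "b i" 1] by simp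
qed

lemma summable_ell2_inner:
  assumes "\<phi> \<in> ell2" "\<psi> \<in> ell2"
  shows "summable (\<lambda>n. cnj (\<phi> n) * \<psi> n)"
proof (rule summable_norm_cancel)
  have "summable (\<lambda>n. (cmod (\<phi> n))\<^sup>2 + (cmod (\<psi> n))\<^sup>2)"
    using assms by (intro summable_add ell2_summable)
  then show "summable (\<lambda>n. norm (cnj (\<phi> n) * \<psi> n))"
  proof (rule summable_comparison_test'[where N = 0])
    fix n :: nat
    show "norm (norm (cnj (\<phi> n) * \<psi> n)) \<le> (cmod (\<phi> n))\<^sup>2 + (cmod (\<psi> n))\<^sup>2"
      using sum_squares_bound[of "cmod (\<phi> n)" "cmod (\<psi> n)"]
        mult_nonneg_nonneg[OF norm_ge_zero norm_ge_zero, of "\<phi> n" "\<psi> n"]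
      unfolding norm_mult complex_mod_cnj real_norm_def abs_mult abs_norm_cancel by linarith
  qed
qed

lemma ell2_inner_lincomb_right:
  assumes "\<eta> \<in> ell2" "\<phi> \<in> ell2" "\<psi> \<in> ell2"
  shows "ell2_inner \<eta> (\<lambda>n. a * \<phi> n + b * \<psi> n) = a * ell2_inner \<eta> \<phi> + b * ell2_inner \<eta> \<psi>"
proof -
  have "ell2_inner \<eta> (\<lambda>n. a * \<phi> n + b * \<psi> n)
      = (\<Sum>n. a * (cnj (\<eta> n) * \<phi> n) + b * (cnj (\<eta> n) * \<psi> n))"
    unfolding ell2_inner_def by (simp add: algebra_simps)
  also have "\<dots> = a * ell2_inner \<eta> \<phi> + b * ell2_inner \<eta> \<psi>"
    using assms unfolding ell2_inner_def
    by (subst suminf_add[symmetric]) (auto intro!: summable_mult summable_ell2_inner simp: suminf_mult summable_ell2_inner)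
  finally show ?thesis .
qed

lemma ell2_inner_commute:
  assumes "\<phi> \<in> ell2" "\<psi> \<in> ell2"
  shows "ell2_inner \<psi> \<phi> = cnj (ell2_inner \<phi> \<psi>)"
proof -
  have "(\<lambda>n. cnj (cnj (\<phi> n) * \<psi> n)) sums cnj (ell2_inner \<phi> \<psi>)"
    unfolding sums_cnj ell2_inner_def by (rule summable_sums[OF summable_ell2_inner[OF assms]])
  then show ?thesis
    unfolding ell2_inner_def by (simp add: sums_iff mult.commute)
qed

lemma ell2_inner_lincomb_left:
  assumes "\<eta> \<in> ell2" "\<phi> \<in> ell2" "\<psi> \<in> ell2"
  shows "ell2_inner (\<lambda>n. a * \<phi> n + b * \<psi> n) \<eta>
    = cnj a * ell2_inner \<phi> \<eta> + cnj b * ell2_inner \<psi> \<eta>"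
  using assms ell2_lincomb[OF assms(2,3), of a b]
  by (simp add: ell2_inner_commute[of \<eta>] ell2_inner_lincomb_right)

lemma ell2_inner_sum_right:
  assumes "finite J" "\<And>j. j \<in> J \<Longrightarrow> p j \<in> ell2" "\<phi> \<in> ell2"
  shows "ell2_inner \<phi> (\<lambda>n. \<Sum>j\<in>J. b j * p j n) = (\<Sum>j\<in>J. b j * ell2_inner \<phi> (p j))"
  using assms
proof (induction J rule: finite_induct)
  case empty
  then show ?case by (simp add: ell2_inner_def)
next
  case (insert i J)
  have "(\<lambda>n. \<Sum>j\<in>J. b j * p j n) \<in> ell2"
    using insert by (intro ell2_sum) auto
  then show ?case
    using insert ell2_inner_lincomb_right[of \<phi> "p i" "\<lambda>n. \<Sum>j\<in>J. b j * p j n" "b i" 1]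
    by simp
qed

lemma ell2_norm_square: "\<psi> \<in> ell2 \<Longrightarrow> (ell2_norm \<psi>)\<^sup>2 = (\<Sum>n. (cmod (\<psi> n))\<^sup>2)"
  unfolding ell2_norm_def by (simp add: suminf_nonneg ell2_summable)

lemma ell2_norm_nonneg: "\<psi> \<in> ell2 \<Longrightarrow> ell2_norm \<psi> \<ge> 0"
  unfolding ell2_norm_def by (simp add: suminf_nonneg ell2_summable)

lemma ell2_inner_self:
  assumes "\<psi> \<in> ell2"
  shows "ell2_inner \<psi> \<psi> = of_real ((ell2_norm \<psi>)\<^sup>2)"
proof -
  have "cnj (\<psi> n) * \<psi> n = of_real ((cmod (\<psi> n))\<^sup>2)" for n
    by (simp only: complex_norm_square mult.commute)
  then show ?thesis
    unfolding ell2_norm_square[OF assms] ell2_inner_def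
    by (simp add: suminf_of_real ell2_summable[OF assms] del: of_real_power)
qed

lemma sum_square_le_ell2_norm:
  assumes "\<psi> \<in> ell2" "finite S"
  shows "(\<Sum>n\<in>S. (cmod (\<psi> n))\<^sup>2) \<le> (ell2_norm \<psi>)\<^sup>2"
  unfolding ell2_norm_square[OF assms(1)]
  by (rule sum_le_suminf[OF ell2_summable[OF assms(1)] assms(2)]) simp

lemma ell2_entry_le:
  assumes "\<psi> \<in> ell2"
  shows "(cmod (\<psi> n))\<^sup>2 \<le> (ell2_norm \<psi>)\<^sup>2"
  using sum_square_le_ell2_norm[OF assms, of "{n}"] by simp

lemma ell2_Cauchy_Schwarz:
  assumes "\<phi> \<in> ell2" "\<psi> \<in> ell2"
  shows "cmod (ell2_inner \<phi> \<psi>) \<le> ell2_norm \<phi> * ell2_norm \<psi>"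
proof (rule LIMSEQ_le_const2)
  show "(\<lambda>N. cmod (\<Sum>n<N. cnj (\<phi> n) * \<psi> n)) \<longlonglongrightarrow> cmod (ell2_inner \<phi> \<psi>)"
    unfolding ell2_inner_def
    by (intro tendsto_norm summable_LIMSEQ summable_ell2_inner assms)
  show "\<exists>M. \<forall>N\<ge>M. cmod (\<Sum>n<N. cnj (\<phi> n) * \<psi> n) \<le> ell2_norm \<phi> * ell2_norm \<psi>"
  proof (intro exI[of _ 0] allI impI)
    fix N :: nat
    have L2: "L2_set (\<lambda>n. cmod (\<eta> n)) {..<N} \<le> ell2_norm \<eta>" if "\<eta> \<in> ell2" for \<eta>
      using sum_square_le_ell2_norm[OF that, of "{..<N}"] ell2_norm_nonneg[OF that]
      by (simp add: L2_set_def real_le_lsqrt)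
    have "cmod (\<Sum>n<N. cnj (\<phi> n) * \<psi> n) \<le> (\<Sum>n<N. \<bar>cmod (\<phi> n)\<bar> * \<bar>cmod (\<psi> n)\<bar>)"
      by (rule order_trans[OF norm_sum]) (simp add: norm_mult)
    also have "\<dots> \<le> L2_set (\<lambda>n. cmod (\<phi> n)) {..<N} * L2_set (\<lambda>n. cmod (\<psi> n)) {..<N}"
      by (rule L2_set_mult_ineq)
    also have "\<dots> \<le> ell2_norm \<phi> * ell2_norm \<psi>"
      by (intro mult_mono L2 assms L2_set_nonneg ell2_norm_nonneg)
    finally show "cmod (\<Sum>n<N. cnj (\<phi> n) * \<psi> n) \<le> ell2_norm \<phi> * ell2_norm \<psi>" .
  qed
qed

text \<open>
  Unit vectors of the sites \<open>k \<ge> 1\<close>. For \<open>k = 0\<close> the sequence is not in \<open>ell2\<close>,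
  which requires the boundary value 0.
\<close>

definition site :: "nat \<Rightarrow> nat \<Rightarrow> complex" where
  "site k n = (if n = k then 1 else 0)"

lemma delta1_eq_site: "delta1 = site 1"
  by (auto simp: delta1_def site_def)

lemma ell2_finite_support: "\<psi> 0 = 0 \<Longrightarrow> (\<And>n. n > N \<Longrightarrow> \<psi> n = 0) \<Longrightarrow> \<psi> \<in> ell2"
  unfolding ell2_def
  by (auto intro!: summable_finite[of "{..N}"] intro: leI)

lemma site_in_ell2: "k \<ge> 1 \<Longrightarrow> site k \<in> ell2"
  by (rule ell2_finite_support[of _ k]) (auto simp: site_def)

lemma ell2_inner_site: "ell2_inner (site k) \<psi> = \<psi> k"
proof -
  have "(\<lambda>n. cnj (site k n) * \<psi> n) = (\<lambda>n. if n = k then \<psi> n else 0)"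
    by (auto simp: site_def)
  then show ?thesis
    using sums_single[of k \<psi>] by (simp add: ell2_inner_def sums_iff)
qed

lemma ell2_norm_site: "k \<ge> 1 \<Longrightarrow> (ell2_norm (site k))\<^sup>2 = 1"
  using ell2_inner_self[OF site_in_ell2, of k] ell2_inner_site[of k "site k"]
  by (simp add: site_def complex_eq_iff)

lemma delta1_in_ell2: "delta1 \<in> ell2"
  by (simp add: delta1_eq_site site_in_ell2)

lemma fourth_roots_distinct:
  "(1::complex) \<noteq> - 1" "(1::complex) \<noteq> \<i>" "(1::complex) \<noteq> - \<i>"
  "(- 1::complex) \<noteq> \<i>" "(- 1::complex) \<noteq> - \<i>" "\<i> \<noteq> - \<i>"
  by (simp_all add: complex_eq_iff)

text \<open>
  Summing over the fourth roots of unity kills the terms with coefficients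
  \<open>cnj c\<close> and \<open>(cnj c)\<^sup>2\<close> and leaves the one with \<open>cnj c * c = 1\<close>. The second pair of vectors is
  kept separate so that it can be the image of the first one under an operator.
\<close>

lemma ell2_polarization:
  assumes "\<phi> \<in> ell2" "\<psi> \<in> ell2" "\<phi>' \<in> ell2" "\<psi>' \<in> ell2"
  shows "4 * ell2_inner \<phi> \<psi>'
    = (\<Sum>c\<in>{1, - 1, \<i>, - \<i>}. cnj c * ell2_inner (\<lambda>n. \<phi> n + c * \<psi> n) (\<lambda>n. \<phi>' n + c * \<psi>' n))"
proof -
  have expand: "ell2_inner (\<lambda>n. \<phi> n + c * \<psi> n) (\<lambda>n. \<phi>' n + c * \<psi>' n)
      = ell2_inner \<phi> \<phi>' + c * ell2_inner \<phi> \<psi>'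
        + cnj c * (ell2_inner \<psi> \<phi>' + c * ell2_inner \<psi> \<psi>')" for c
    using assms ell2_lincomb[OF assms(3,4), of 1 c]
    by (simp add: ell2_inner_lincomb_left[of _ \<phi> \<psi> 1 c, simplified]
        ell2_inner_lincomb_right[of _ \<phi>' \<psi>' 1 c, simplified])
  show ?thesis
    unfolding expand using fourth_roots_distinct by (simp add: algebra_simps)
qed

lemma ell2_norm_add_square_le:
  assumes "\<phi> \<in> ell2" "\<psi> \<in> ell2" "cmod c = 1"
  shows "(ell2_norm (\<lambda>n. \<phi> n + c * \<psi> n))\<^sup>2 \<le> 2 * (ell2_norm \<phi>)\<^sup>2 + 2 * (ell2_norm \<psi>)\<^sup>2"
proof -
  have in_ell2: "(\<lambda>n. \<phi> n + c * \<psi> n) \<in> ell2"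
    using ell2_lincomb[OF assms(1,2), of 1 c] by simp
  have s: "summable (\<lambda>n. 2 * (cmod (\<phi> n))\<^sup>2)" "summable (\<lambda>n. 2 * (cmod (\<psi> n))\<^sup>2)"
    using assms by (auto intro!: summable_mult ell2_summable)
  have "(\<Sum>n. (cmod (\<phi> n + c * \<psi> n))\<^sup>2) \<le> (\<Sum>n. 2 * (cmod (\<phi> n))\<^sup>2 + 2 * (cmod (\<psi> n))\<^sup>2)"
  proof (intro suminf_le summable_add s ell2_summable in_ell2)
    show "(cmod (\<phi> n + c * \<psi> n))\<^sup>2 \<le> 2 * (cmod (\<phi> n))\<^sup>2 + 2 * (cmod (\<psi> n))\<^sup>2" for n
      using cmod_add_square_le[of "\<phi> n" "c * \<psi> n"] assms(3) by (simp add: norm_mult)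
  qed
  also have "\<dots> = 2 * (\<Sum>n. (cmod (\<phi> n))\<^sup>2) + 2 * (\<Sum>n. (cmod (\<psi> n))\<^sup>2)"
    using assms by (simp add: suminf_add[OF s, symmetric] suminf_mult ell2_summable)
  finally show ?thesis
    using assms in_ell2 by (simp add: ell2_norm_square)
qed

lemma ell2_norm_orthogonal_sum:
  assumes "finite J" "\<And>j. j \<in> J \<Longrightarrow> p j \<in> ell2"
    and orth: "\<And>i j. i \<in> J \<Longrightarrow> j \<in> J \<Longrightarrow> i \<noteq> j \<Longrightarrow> ell2_inner (p i) (p j) = 0"
  shows "(ell2_norm (\<lambda>n. \<Sum>j\<in>J. b j * p j n))\<^sup>2 = (\<Sum>j\<in>J. (cmod (b j))\<^sup>2 * (ell2_norm (p j))\<^sup>2)"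
proof -
  define s where "s = (\<lambda>n. \<Sum>j\<in>J. b j * p j n)"
  have s: "s \<in> ell2"
    unfolding s_def by (intro ell2_sum assms)
  have coeff: "ell2_inner s (p j) = cnj (b j) * of_real ((ell2_norm (p j))\<^sup>2)" if j: "j \<in> J" for j
  proof -
    have "ell2_inner (p j) s = (\<Sum>i\<in>J. b i * ell2_inner (p j) (p i))"
      unfolding s_def using j by (intro ell2_inner_sum_right assms)
    also have "\<dots> = (\<Sum>i\<in>J. if i = j then b j * ell2_inner (p j) (p j) else 0)"
      using j orth by (intro sum.cong) auto
    also have "\<dots> = b j * of_real ((ell2_norm (p j))\<^sup>2)"
      using j assms by (simp add: ell2_inner_self)
    finally show ?thesis
      using ell2_inner_commute[OF assms(2)[OF j] s] by simp
  qed
  have "complex_of_real ((ell2_norm s)\<^sup>2) = ell2_inner s s"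
    using ell2_inner_self[OF s] by simp
  also have "\<dots> = (\<Sum>j\<in>J. b j * ell2_inner s (p j))"
    by (subst (2) s_def) (intro ell2_inner_sum_right assms s)
  also have "\<dots> = (\<Sum>j\<in>J. of_real ((cmod (b j))\<^sup>2 * (ell2_norm (p j))\<^sup>2))"
  proof (rule sum.cong[OF refl])
    fix j assume "j \<in> J"
    then show "b j * ell2_inner s (p j) = of_real ((cmod (b j))\<^sup>2 * (ell2_norm (p j))\<^sup>2)"
      using complex_norm_square[of "b j"] by (simp add: coeff)
  qed
  finally have "complex_of_real ((ell2_norm s)\<^sup>2)
      = of_real (\<Sum>j\<in>J. (cmod (b j))\<^sup>2 * (ell2_norm (p j))\<^sup>2)"
    by simp
  then show ?thesis
    unfolding s_def by (rule of_real_eq_iff[THEN iffD1])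
qed

section \<open>Scalar spectral measures\<close>

locale spectral_projections =
  fixes P :: "real set \<Rightarrow> (nat \<Rightarrow> complex) \<Rightarrow> (nat \<Rightarrow> complex)"
  assumes pvm: "projection_valued_measure P"
begin

lemma proj: "A \<in> sets borel \<Longrightarrow> ell2_projection (P A)"
  using pvm by (simp add: projection_valued_measure_def)

lemma P_in_ell2: "A \<in> sets borel \<Longrightarrow> \<psi> \<in> ell2 \<Longrightarrow> P A \<psi> \<in> ell2"
  using proj by (simp add: ell2_projection_def)

lemma P_lincomb:
  "A \<in> sets borel \<Longrightarrow> \<phi> \<in> ell2 \<Longrightarrow> \<psi> \<in> ell2 \<Longrightarrow>
    P A (\<lambda>n. a * \<phi> n + b * \<psi> n) = (\<lambda>n. a * P A \<phi> n + b * P A \<psi> n)"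
  using proj by (simp add: ell2_projection_def)

lemma P_selfadjoint:
  "A \<in> sets borel \<Longrightarrow> \<phi> \<in> ell2 \<Longrightarrow> \<psi> \<in> ell2 \<Longrightarrow> ell2_inner \<phi> (P A \<psi>) = ell2_inner (P A \<phi>) \<psi>"
  using proj by (simp add: ell2_projection_def)

lemma P_Int: "A \<in> sets borel \<Longrightarrow> B \<in> sets borel \<Longrightarrow> \<psi> \<in> ell2 \<Longrightarrow> P A (P B \<psi>) = P (A \<inter> B) \<psi>"
  using pvm by (simp add: projection_valued_measure_def)

lemma P_empty: "\<psi> \<in> ell2 \<Longrightarrow> P {} \<psi> = (\<lambda>n. 0)"
  using pvm by (simp add: projection_valued_measure_def)

lemma P_UNIV: "\<psi> \<in> ell2 \<Longrightarrow> P UNIV \<psi> = \<psi>"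
  using pvm by (simp add: projection_valued_measure_def)

lemma inner_P_eq_norm:
  assumes "A \<in> sets borel" "\<psi> \<in> ell2"
  shows "ell2_inner \<psi> (P A \<psi>) = of_real ((ell2_norm (P A \<psi>))\<^sup>2)"
proof -
  have "ell2_inner \<psi> (P A \<psi>) = ell2_inner \<psi> (P A (P A \<psi>))"
    using P_Int[of A A \<psi>] assms by simp
  also have "\<dots> = ell2_inner (P A \<psi>) (P A \<psi>)"
    using assms by (intro P_selfadjoint P_in_ell2)
  finally show ?thesis
    using ell2_inner_self[OF P_in_ell2[OF assms]] by simp
qed

lemma sets_scalar_measure [simp, measurable_cong]: "sets (scalar_measure P \<psi>) = sets borel"
  by (simp add: scalar_measure_def sets.sigma_sets_eq[of borel, simplified])

lemma space_scalar_measure [simp]: "space (scalar_measure P \<psi>) = UNIV"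
  by (simp add: scalar_measure_def)

text \<open>
  The set function in the definition of \<open>scalar_measure\<close> really is a measure: by Cauchy-Schwarz,
  strong countable additivity of the projections passes to their quadratic forms.
\<close>

lemma emeasure_scalar_measure:
  assumes "A \<in> sets borel" "\<psi> \<in> ell2"
  shows "emeasure (scalar_measure P \<psi>) A = ennreal ((ell2_norm (P A \<psi>))\<^sup>2)"
proof -
  define f where "f = (\<lambda>A. ennreal (Re (ell2_inner \<psi> (P A \<psi>))))"
  have "emeasure (scalar_measure P \<psi>) A = f A"
  proof (rule emeasure_measure_of[of _ UNIV "sets borel" f])
    show "scalar_measure P \<psi> = measure_of UNIV (sets borel) f"
      by (simp add: scalar_measure_def f_def)
    show "positive (sets (scalar_measure P \<psi>)) f"
      using P_empty[OF assms(2)] by (simp add: positive_def f_def ell2_inner_def)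
    show "countably_additive (sets (scalar_measure P \<psi>)) f"
    proof (rule countably_additiveI)
      fix B :: "nat \<Rightarrow> real set"
      assume B: "range B \<subseteq> sets (scalar_measure P \<psi>)" "disjoint_family B"
        "(\<Union>i. B i) \<in> sets (scalar_measure P \<psi>)"
      then have B': "range B \<subseteq> sets borel" "\<And>i. B i \<in> sets borel" "(\<Union>i. B i) \<in> sets borel"
        by auto
      define rest where "rest N n = P (\<Union>i. B i) \<psi> n - (\<Sum>i<N. P (B i) \<psi> n)" for N n
      have lim: "(\<lambda>N. ell2_norm (rest N)) \<longlonglongrightarrow> 0"
        using pvm B(2) B'(1) assms(2) unfolding projection_valued_measure_def rest_def by blast
      have partial: "(\<lambda>n. \<Sum>i<N. P (B i) \<psi> n) \<in> ell2" for N
        using ell2_sum[of "{..<N}" "\<lambda>i. P (B i) \<psi>" "\<lambda>_. 1"] B'(2) assms(2)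
        by (simp add: P_in_ell2)
      have rest_in: "rest N \<in> ell2" for N
        unfolding rest_def by (intro ell2_diff partial P_in_ell2 B' assms)
      have inner_rest: "ell2_inner \<psi> (rest N)
          = ell2_inner \<psi> (P (\<Union>i. B i) \<psi>) - (\<Sum>i<N. ell2_inner \<psi> (P (B i) \<psi>))" for N
      proof -
        have "ell2_inner \<psi> (\<lambda>n. \<Sum>i<N. P (B i) \<psi> n) = (\<Sum>i<N. ell2_inner \<psi> (P (B i) \<psi>))"
          using ell2_inner_sum_right[of "{..<N}" "\<lambda>i. P (B i) \<psi>" \<psi> "\<lambda>_. 1"] B'(2) assms(2)
          by (simp add: P_in_ell2)
        then show ?thesis
          unfolding rest_def
          using ell2_inner_lincomb_right[OF assms(2) P_in_ell2[OF B'(3) assms(2)] partial[of N], of 1 "-1"]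
          by simp
      qed
      have "(\<lambda>N. ell2_inner \<psi> (rest N)) \<longlonglongrightarrow> 0"
      proof (rule Lim_null_comparison)
        show "\<forall>\<^sub>F N in sequentially. cmod (ell2_inner \<psi> (rest N)) \<le> ell2_norm \<psi> * ell2_norm (rest N)"
          using ell2_Cauchy_Schwarz[OF assms(2) rest_in] by simp
        show "(\<lambda>N. ell2_norm \<psi> * ell2_norm (rest N)) \<longlonglongrightarrow> 0"
          using tendsto_mult_left[OF lim, of "ell2_norm \<psi>"] by simp
      qed
      then have "(\<lambda>N. \<Sum>i<N. ell2_inner \<psi> (P (B i) \<psi>)) \<longlonglongrightarrow> ell2_inner \<psi> (P (\<Union>i. B i) \<psi>)"
        unfolding inner_rest
        using tendsto_diff[OF tendsto_const[of "ell2_inner \<psi> (P (\<Union>i. B i) \<psi>)"]] by fastforce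
      then have "(\<lambda>i. Re (ell2_inner \<psi> (P (B i) \<psi>))) sums Re (ell2_inner \<psi> (P (\<Union>i. B i) \<psi>))"
        by (intro sums_Re) (simp add: sums_def)
      moreover have "Re (ell2_inner \<psi> (P (B i) \<psi>)) \<ge> 0" for i
        using inner_P_eq_norm[OF B'(2) assms(2)] by simp
      ultimately show "(\<Sum>i. f (B i)) = f (\<Union> (range B))"
        unfolding f_def by (subst suminf_ennreal_eq) auto
    qed
  qed (use assms(1) sets.space_closed[of borel] in auto)
  then show ?thesis
    using inner_P_eq_norm[OF assms] by (simp add: f_def)
qed

lemma finite_scalar_measure: "\<psi> \<in> ell2 \<Longrightarrow> finite_measure (scalar_measure P \<psi>)"
  by (intro finite_measureI) (simp add: emeasure_scalar_measure)

lemma measure_scalar_measure: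
  "A \<in> sets borel \<Longrightarrow> \<psi> \<in> ell2 \<Longrightarrow>
    measure (scalar_measure P \<psi>) A = (ell2_norm (P A \<psi>))\<^sup>2"
  by (simp add: measure_def emeasure_scalar_measure)

lemma AE_scalar_measure_in:
  assumes "A \<in> sets borel" "\<psi> \<in> ell2" "P A \<psi> = \<psi>"
  shows "AE x in scalar_measure P \<psi>. x \<in> A"
proof (rule AE_I)
  have "P (- A) \<psi> = P (- A \<inter> A) \<psi>"
    using P_Int[of "- A" A \<psi>] assms by (simp add: borel_comp)
  then have "ell2_norm (P (- A) \<psi>) = 0"
    using P_empty[OF assms(2)] by (simp add: ell2_norm_def)
  then show "emeasure (scalar_measure P \<psi>) (- A) = 0"
    using assms by (simp add: emeasure_scalar_measure borel_comp)
  show "- A \<in> sets (scalar_measure P \<psi>)"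
    using assms by (simp add: borel_comp)
qed auto

text \<open>
  The scalar measure of a vector in the range of \<open>P A\<close> lives on \<open>A\<close>. If \<open>A\<close> has diameter at most
  \<open>d\<close>, the first moment is therefore \<open>c\<close> times the mass, up to \<open>d\<close> times the mass.
\<close>

lemma localized_moments:
  assumes "A \<in> sets borel" "\<psi> \<in> ell2" "P A \<psi> = \<psi>" "A \<subseteq> {c..c + d}" "d \<ge> 0"
  shows "integrable (scalar_measure P \<psi>) (\<lambda>x. x\<^sup>2)"
    and "\<bar>(LINT x|scalar_measure P \<psi>. x) - c * (ell2_norm \<psi>)\<^sup>2\<bar> \<le> d * (ell2_norm \<psi>)\<^sup>2"
proof -
  interpret finite_measure "scalar_measure P \<psi>"
    by (rule finite_scalar_measure[OF assms(2)])
  have ae: "AE x in scalar_measure P \<psi>. c \<le> x \<and> x \<le> c + d"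
    using AE_scalar_measure_in[OF assms(1-3)] assms(4) by (auto elim!: eventually_mono)
  have le: "\<bar>x\<bar> \<le> \<bar>c\<bar> + d" if "c \<le> x \<and> x \<le> c + d" for x
    using that by linarith
  show "integrable (scalar_measure P \<psi>) (\<lambda>x. x\<^sup>2)"
  proof (rule integrable_const_bound[where B = "(\<bar>c\<bar> + d)\<^sup>2"])
    show "AE x in scalar_measure P \<psi>. norm (x\<^sup>2) \<le> (\<bar>c\<bar> + d)\<^sup>2"
      using ae by eventually_elim (use le in \<open>force simp: abs_le_square_iff[symmetric]\<close>)
  qed measurable
  have int: "integrable (scalar_measure P \<psi>) (\<lambda>x. x)"
    by (rule integrable_const_bound[where B = "\<bar>c\<bar> + d"])
       (use ae le in \<open>auto simp del: eventually_conj_iff elim: eventually_mono\<close>)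
  have mass: "measure (scalar_measure P \<psi>) UNIV = (ell2_norm \<psi>)\<^sup>2"
    using assms(2) by (simp add: measure_scalar_measure P_UNIV)
  have "(LINT x|scalar_measure P \<psi>. c) \<le> (LINT x|scalar_measure P \<psi>. x)"
    by (intro integral_mono_AE int) (use ae in auto)
  moreover have "(LINT x|scalar_measure P \<psi>. x) \<le> (LINT x|scalar_measure P \<psi>. c + d)"
    by (intro integral_mono_AE int) (use ae in auto)
  ultimately show "\<bar>(LINT x|scalar_measure P \<psi>. x) - c * (ell2_norm \<psi>)\<^sup>2\<bar> \<le> d * (ell2_norm \<psi>)\<^sup>2"
    using mass by (simp add: algebra_simps)
qed

end

section \<open>Lattice sums for integrals\<close>

text \<open>
  For \<open>m > 0\<close> this is the half-open interval \<open>[j / m, (j + 1) / m)\<close>.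
\<close>

definition mesh_cell :: "nat \<Rightarrow> int \<Rightarrow> real set" where
  "mesh_cell m j = {x. \<lfloor>real m * x\<rfloor> = j}"

text \<open>
  The cells with these indices cover \<open>[-m, m]\<close>, so that for growing \<open>m\<close> they are finitely many,
  exhaust the line, and become small at the same time.
\<close>

definition mesh_indices :: "nat \<Rightarrow> int set" where
  "mesh_indices m = {- int (m\<^sup>2) .. int (m\<^sup>2)}"

lemma finite_mesh_indices [simp]: "finite (mesh_indices m)"
  by (simp add: mesh_indices_def)

lemma borel_mesh_cell [measurable, simp]: "mesh_cell m j \<in> sets borel"
  unfolding mesh_cell_def by measurable

lemma mesh_cell_disjoint: "i \<noteq> j \<Longrightarrow> mesh_cell m i \<inter> mesh_cell m j = {}"
  by (auto simp: mesh_cell_def)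

lemma mesh_cell_subset:
  assumes "m > 0"
  shows "mesh_cell m j \<subseteq> {of_int j / real m .. of_int j / real m + 1 / real m}"
proof
  fix x assume "x \<in> mesh_cell m j"
  then have "of_int j \<le> real m * x" "real m * x \<le> of_int j + 1"
    by (auto simp: mesh_cell_def)
  then show "x \<in> {of_int j / real m .. of_int j / real m + 1 / real m}"
    using assms by (simp add: field_simps)
qed

text \<open>
  The lattice sums are integrals of step functions that are bounded by \<open>B\<close> and converge pointwise to
  \<open>g\<close>, so dominated convergence applies. Below, the total mass, the Borel transform and the
  integral of \<open>1 / \<bar>x - z\<bar>\<^sup>2\<close> are all obtained as such limits.
\<close>

lemma mesh_sum_tendsto_integral:
  fixes g :: "real \<Rightarrow> 'a::{banach, second_countable_topology}"
  assumes M: "finite_measure M" and sets_M: "sets M = sets borel"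
    and g: "continuous_on UNIV g" and bound: "\<And>x. norm (g x) \<le> B"
  shows "(\<lambda>m. \<Sum>j\<in>mesh_indices m. measure M (mesh_cell m j) *\<^sub>R g (of_int j / real m))
    \<longlonglongrightarrow> (LINT x|M. g x)"
proof -
  interpret finite_measure M by (rule M)
  define s where "s m x = (\<Sum>j\<in>mesh_indices m. indicator (mesh_cell m j) x *\<^sub>R g (of_int j / real m))"
    for m x
  have s_eq: "s m x = (if \<lfloor>real m * x\<rfloor> \<in> mesh_indices m then g (of_int \<lfloor>real m * x\<rfloor> / real m) else 0)"
    for m x
  proof -
    have "s m x = (\<Sum>j\<in>mesh_indices m. if \<lfloor>real m * x\<rfloor> = j then g (of_int j / real m) else 0)"
      unfolding s_def by (intro sum.cong) (auto simp: mesh_cell_def)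
    then show ?thesis by simp
  qed
  have [measurable]: "mesh_cell m j \<in> sets M" for m j
    by (simp add: sets_M)
  have [measurable]: "g \<in> borel_measurable M"
    using borel_measurable_continuous_onI[OF g] measurable_cong_sets[OF sets_M refl] by blast
  have [measurable]: "s m \<in> borel_measurable M" for m
    unfolding s_def by measurable
  have "B \<ge> 0"
    using bound[of 0] norm_ge_zero[of "g 0"] by linarith
  have "(\<lambda>m. LINT x|M. s m x) \<longlonglongrightarrow> (LINT x|M. g x)"
  proof (rule integral_dominated_convergence[where w = "\<lambda>_. B"])
    show "AE x in M. (\<lambda>m. s m x) \<longlonglongrightarrow> g x"
    proof (rule AE_I2)
      fix x
      have "(\<lambda>m. of_int \<lfloor>real m * x\<rfloor> / real m) \<longlonglongrightarrow> x"
      proof (rule LIM_zero_cancel, rule Lim_null_comparison)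
        show "\<forall>\<^sub>F m in sequentially. norm (of_int \<lfloor>real m * x\<rfloor> / real m - x) \<le> 1 / real m"
          using eventually_gt_at_top[of 0]
        proof eventually_elim
          case (elim m)
          have "of_int \<lfloor>real m * x\<rfloor> / real m - x = (of_int \<lfloor>real m * x\<rfloor> - real m * x) / real m"
            using elim by (simp add: field_simps)
          moreover have "\<bar>of_int \<lfloor>real m * x\<rfloor> - real m * x\<bar> \<le> 1"
            by linarith
          ultimately show ?case
            using elim by (simp add: divide_right_mono)
        qed
        show "(\<lambda>m. 1 / real m) \<longlonglongrightarrow> 0"
          by (rule lim_1_over_n)
      qed
      then have "(\<lambda>m. g (of_int \<lfloor>real m * x\<rfloor> / real m)) \<longlonglongrightarrow> g x"
        using g by (intro isCont_tendsto_compose[where g = g]) (simp_all add: continuous_on_eq_continuous_at)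
      moreover have "\<forall>\<^sub>F m in sequentially. s m x = g (of_int \<lfloor>real m * x\<rfloor> / real m)"
        using eventually_ge_at_top[of "nat \<lceil>\<bar>x\<bar> + 1\<rceil>"]
      proof eventually_elim
        case (elim m)
        then have m: "real m \<ge> \<bar>x\<bar> + 1" by linarith
        then have "real m * (\<bar>x\<bar> + 1) \<le> real m * real m"
          by (intro mult_left_mono) auto
        then have "\<bar>real m * x\<bar> + 1 \<le> real (m\<^sup>2)"
          using m by (simp add: abs_mult power2_eq_square algebra_simps)
        then have "\<lfloor>real m * x\<rfloor> \<in> mesh_indices m"
          unfolding mesh_indices_def atLeastAtMost_iff by linarith
        then show ?case by (simp add: s_eq)
      qed
      ultimately show "(\<lambda>m. s m x) \<longlonglongrightarrow> g x"
        by (simp add: tendsto_cong)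
    qed
    show "AE x in M. norm (s m x) \<le> B" for m
      using bound \<open>B \<ge> 0\<close> by (simp add: s_eq)
  qed auto
  moreover have "(LINT x|M. s m x)
      = (\<Sum>j\<in>mesh_indices m. measure M (mesh_cell m j) *\<^sub>R g (of_int j / real m))" for m
    unfolding s_def
    by (subst Bochner_Integration.integral_sum) (auto intro!: sum.cong simp: less_top[symmetric] sets_M)
  ultimately show ?thesis by simp
qed

section \<open>Spectral localization of the form\<close>

locale schroedinger_resolution =
  fixes V :: "nat \<Rightarrow> real" and P :: "real set \<Rightarrow> (nat \<Rightarrow> complex) \<Rightarrow> (nat \<Rightarrow> complex)"
  assumes resolution: "spectral_resolution (schroedinger V) (schroedinger_domain V) P"
begin

sublocale spectral_projections P
  using resolution by unfold_locales (simp add: spectral_resolution_def)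

abbreviation "H \<equiv> schroedinger V"
abbreviation "Dom \<equiv> schroedinger_domain V"

lemma domD: "\<psi> \<in> Dom \<Longrightarrow> \<psi> \<in> ell2" "\<psi> \<in> Dom \<Longrightarrow> H \<psi> \<in> ell2"
  by (simp_all add: schroedinger_domain_def)

lemma domI: "\<psi> \<in> ell2 \<Longrightarrow> integrable (scalar_measure P \<psi>) (\<lambda>x. x\<^sup>2) \<Longrightarrow> \<psi> \<in> Dom"
  using resolution by (simp add: spectral_resolution_def)

lemma form_eq_mean: "\<psi> \<in> Dom \<Longrightarrow> ell2_inner \<psi> (H \<psi>) = of_real (LINT x|scalar_measure P \<psi>. x)"
  using resolution by (simp add: spectral_resolution_def)

lemma H_lincomb: "H (\<lambda>n. a * \<phi> n + b * \<psi> n) = (\<lambda>n. a * H \<phi> n + b * H \<psi> n)"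
  by (auto simp: schroedinger_def algebra_simps)

lemma H_add_scale: "H (\<lambda>n. \<phi> n + c * \<psi> n) = (\<lambda>n. H \<phi> n + c * H \<psi> n)"
  using H_lincomb[of 1 \<phi> c \<psi>] by simp

lemma dom_lincomb: "\<phi> \<in> Dom \<Longrightarrow> \<psi> \<in> Dom \<Longrightarrow> (\<lambda>n. a * \<phi> n + b * \<psi> n) \<in> Dom"
  by (simp add: schroedinger_domain_def H_lincomb ell2_lincomb)

lemma site_in_dom: "k \<ge> 1 \<Longrightarrow> site k \<in> Dom"
  unfolding schroedinger_domain_def
  by (auto intro!: ell2_finite_support[of _ "k + 1"] simp: site_in_ell2 schroedinger_def)
     (auto simp: site_def)

lemma inner_P_orthogonal:
  assumes "A \<in> sets borel" "C \<in> sets borel" "\<phi> \<in> ell2" "\<psi> \<in> ell2" "P A \<psi> = \<psi>" "P A \<phi> = (\<lambda>n. 0)"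
  shows "ell2_inner \<phi> (P C \<psi>) = 0"
proof -
  have "P C \<psi> = P A (P C \<psi>)"
    using P_Int[of C A \<psi>] P_Int[of A C \<psi>] assms by (simp add: Int_commute)
  then have "ell2_inner \<phi> (P C \<psi>) = ell2_inner (P A \<phi>) (P C \<psi>)"
    using P_selfadjoint[of A \<phi> "P C \<psi>"] P_in_ell2[of C \<psi>] assms by simp
  then show ?thesis
    using assms by (simp add: ell2_inner_def)
qed

text \<open>
  Adding \<open>c * \<psi>\<close> to \<open>\<phi>\<close> with \<open>cmod c = 1\<close> gives a vector whose scalar measure does not depend on \<open>c\<close>,
  because the mixed terms \<open>ell2_inner \<phi> (P C \<psi>)\<close> vanish. Its form, the mean of that measure, is then
  independent of \<open>c\<close> as well, and polarization averages a constant against \<open>cnj c\<close>.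
\<close>

lemma form_vanishes_across:
  assumes "A \<in> sets borel" "\<phi> \<in> Dom" "\<psi> \<in> Dom" "P A \<psi> = \<psi>" "P A \<phi> = (\<lambda>n. 0)"
  shows "ell2_inner \<phi> (H \<psi>) = 0"
proof -
  note in_ell2 = domD(1)[OF assms(2)] domD(1)[OF assms(3)]
  define \<eta> where "\<eta> c = (\<lambda>n. \<phi> n + c * \<psi> n)" for c :: complex
  have \<eta>_Dom: "\<eta> c \<in> Dom" for c
    using dom_lincomb[OF assms(2,3), of 1 c] by (simp add: \<eta>_def)
  have form: "ell2_inner (\<eta> c) (P C (\<eta> c)) = ell2_inner \<phi> (P C \<phi>) + ell2_inner \<psi> (P C \<psi>)"
    if "cmod c = 1" "C \<in> sets borel" for c C
  proof -
    have in_P: "P C \<phi> \<in> ell2" "P C \<psi> \<in> ell2"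
      using that in_ell2 by (simp_all add: P_in_ell2)
    have "ell2_inner \<phi> (P C \<psi>) = 0"
      using inner_P_orthogonal[OF assms(1) that(2) in_ell2 assms(4,5)] .
    moreover have "ell2_inner \<psi> (P C \<phi>) = 0"
      using calculation P_selfadjoint[OF that(2) in_ell2] ell2_inner_commute[OF in_P(1) in_ell2(2)]
      by simp
    moreover have "cnj c * c = 1"
      using that complex_norm_square[of c] by (simp add: mult.commute)
    ultimately show ?thesis
      unfolding \<eta>_def P_lincomb[OF that(2) in_ell2, of 1 c, simplified]
      using in_ell2 in_P ell2_lincomb[OF in_P, of 1 c]
      by (simp add: ell2_inner_lincomb_left[of _ \<phi> \<psi> 1 c, simplified]
          ell2_inner_lincomb_right[of _ "P C \<phi>" "P C \<psi>" 1 c, simplified] mult.assoc[symmetric])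
  qed
  have same: "scalar_measure P (\<eta> c) = scalar_measure P (\<eta> 1)" if "cmod c = 1" for c
    unfolding scalar_measure_def
    by (rule measure_of_eq) (simp_all add: sets.sigma_sets_eq[of borel, simplified] form[OF that] form[OF norm_one])
  have q: "ell2_inner (\<eta> c) (H (\<eta> c)) = ell2_inner (\<eta> 1) (H (\<eta> 1))" if "cmod c = 1" for c
    unfolding form_eq_mean[OF \<eta>_Dom] by (simp only: same[OF that])
  have "4 * ell2_inner \<phi> (H \<psi>) = (\<Sum>c\<in>{1, - 1, \<i>, - \<i>}. cnj c * ell2_inner (\<eta> c) (H (\<eta> c)))"
    using ell2_polarization[OF in_ell2 domD(2)[OF assms(2)] domD(2)[OF assms(3)]]
    unfolding \<eta>_def H_add_scale .
  also have "\<dots> = (\<Sum>c\<in>{1, - 1, \<i>, - \<i>}. cnj c * ell2_inner (\<eta> 1) (H (\<eta> 1)))"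
  proof (rule sum.cong[OF refl])
    fix t :: complex assume "t \<in> {1, - 1, \<i>, - \<i>}"
    then have "cmod t = 1" by auto
    then show "cnj t * ell2_inner (\<eta> t) (H (\<eta> t)) = cnj t * ell2_inner (\<eta> 1) (H (\<eta> 1))"
      by (simp only: q)
  qed
  also have "\<dots> = 0"
    using fourth_roots_distinct by simp
  finally show ?thesis by simp
qed

lemma localized_in_dom:
  assumes "A \<in> sets borel" "A \<subseteq> {c..c + d}" "d \<ge> 0" "\<psi> \<in> ell2" "P A \<psi> = \<psi>"
  shows "\<psi> \<in> Dom"
  using localized_moments(1)[OF assms(1,4,5,2,3)] assms(4) by (rule domI[rotated])

text \<open>
  On vectors of the range of \<open>P A\<close> the quadratic form of \<open>H - c\<close> is small by \<open>localized_moments\<close>; polarization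
  carries this over to the sesquilinear form.
\<close>

lemma form_bound_within:
  assumes A: "A \<in> sets borel" "A \<subseteq> {c..c + d}" "d \<ge> 0"
    and \<phi>: "\<phi> \<in> ell2" "P A \<phi> = \<phi>" and \<psi>: "\<psi> \<in> ell2" "P A \<psi> = \<psi>"
  shows "cmod (ell2_inner \<phi> (H \<psi>) - of_real c * ell2_inner \<phi> \<psi>)
    \<le> 2 * d * ((ell2_norm \<phi>)\<^sup>2 + (ell2_norm \<psi>)\<^sup>2)"
proof -
  define \<eta> where "\<eta> c = (\<lambda>n. \<phi> n + c * \<psi> n)" for c :: complex
  let ?roots = "{1, - 1, \<i>, - \<i>} :: complex set"
  let ?B = "2 * d * ((ell2_norm \<phi>)\<^sup>2 + (ell2_norm \<psi>)\<^sup>2)"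
  have \<eta>: "\<eta> t \<in> ell2" "P A (\<eta> t) = \<eta> t" for t
    using ell2_lincomb[OF \<phi>(1) \<psi>(1), of 1 t] P_lincomb[OF A(1) \<phi>(1) \<psi>(1), of 1 t] \<phi> \<psi>
    by (simp_all add: \<eta>_def)
  have in_dom: "\<phi> \<in> Dom" "\<psi> \<in> Dom" "\<eta> t \<in> Dom" for t
    using localized_in_dom[OF A] \<phi> \<psi> \<eta> by auto
  have term_le: "cmod (cnj t * (ell2_inner (\<eta> t) (H (\<eta> t)) - of_real c * ell2_inner (\<eta> t) (\<eta> t))) \<le> ?B"
    if t: "t \<in> ?roots" for t
  proof -
    have "cmod t = 1"
      using t by auto
    have "ell2_inner (\<eta> t) (H (\<eta> t)) - of_real c * ell2_inner (\<eta> t) (\<eta> t)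
        = of_real ((LINT x|scalar_measure P (\<eta> t). x) - c * (ell2_norm (\<eta> t))\<^sup>2)"
      by (simp add: form_eq_mean[OF in_dom(3)] ell2_inner_self[OF \<eta>(1)])
    then have "cmod (cnj t * (ell2_inner (\<eta> t) (H (\<eta> t)) - of_real c * ell2_inner (\<eta> t) (\<eta> t)))
        = \<bar>(LINT x|scalar_measure P (\<eta> t). x) - c * (ell2_norm (\<eta> t))\<^sup>2\<bar>"
      using \<open>cmod t = 1\<close> by (simp add: norm_mult del: of_real_diff of_real_mult of_real_power)
    also have "\<dots> \<le> d * (ell2_norm (\<eta> t))\<^sup>2"
      by (rule localized_moments(2)[OF A(1) \<eta> A(2,3)])
    also have "\<dots> \<le> d * (2 * (ell2_norm \<phi>)\<^sup>2 + 2 * (ell2_norm \<psi>)\<^sup>2)"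
      unfolding \<eta>_def using A(3) \<open>cmod t = 1\<close>
      by (intro mult_left_mono ell2_norm_add_square_le \<phi> \<psi>)
    finally show ?thesis by (simp add: algebra_simps)
  qed
  have "4 * (ell2_inner \<phi> (H \<psi>) - of_real c * ell2_inner \<phi> \<psi>)
      = 4 * ell2_inner \<phi> (H \<psi>) - of_real c * (4 * ell2_inner \<phi> \<psi>)"
    by (simp add: algebra_simps)
  also have "4 * ell2_inner \<phi> (H \<psi>) = (\<Sum>t\<in>?roots. cnj t * ell2_inner (\<eta> t) (H (\<eta> t)))"
    using ell2_polarization[OF \<phi>(1) \<psi>(1) domD(2)[OF in_dom(1)] domD(2)[OF in_dom(2)]]
    unfolding \<eta>_def H_add_scale .
  also have "4 * ell2_inner \<phi> \<psi> = (\<Sum>t\<in>?roots. cnj t * ell2_inner (\<eta> t) (\<eta> t))"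
    using ell2_polarization[OF \<phi>(1) \<psi>(1) \<phi>(1) \<psi>(1)] unfolding \<eta>_def .
  finally have "4 * (ell2_inner \<phi> (H \<psi>) - of_real c * ell2_inner \<phi> \<psi>)
      = (\<Sum>t\<in>?roots. cnj t * (ell2_inner (\<eta> t) (H (\<eta> t)) - of_real c * ell2_inner (\<eta> t) (\<eta> t)))"
    by (simp only: sum_distrib_left sum_subtractf right_diff_distrib mult.left_commute)
  then have "4 * cmod (ell2_inner \<phi> (H \<psi>) - of_real c * ell2_inner \<phi> \<psi>)
      = cmod (\<Sum>t\<in>?roots. cnj t * (ell2_inner (\<eta> t) (H (\<eta> t)) - of_real c * ell2_inner (\<eta> t) (\<eta> t)))"
    by (metis norm_mult norm_numeral)
  also have "\<dots> \<le> (\<Sum>t\<in>?roots. ?B)"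
    by (rule sum_norm_le) (rule term_le)
  also have "\<dots> = 4 * ?B"
    using fourth_roots_distinct by simp
  finally show ?thesis by simp
qed

text \<open>
  The definition of a spectral resolution gives only quadratic forms. This weak form of
  \<open>\<parallel>(H - c) P A \<psi>\<parallel> \<le> d \<parallel>P A \<psi>\<parallel>\<close> is what remains of the functional calculus: the part of \<open>\<phi>\<close> outside the
  range of \<open>P A\<close> contributes nothing by \<open>form_vanishes_across\<close>. With \<open>\<phi>\<close> a unit vector of a site
  it controls a single entry of \<open>H (P A \<psi>)\<close>, and the squares on the right can be summed over
  disjoint sets \<open>A\<close>.
\<close>

lemma H_localized_bound:
  assumes A: "A \<in> sets borel" "A \<subseteq> {c..c + d}" "d \<ge> 0"
    and \<phi>: "\<phi> \<in> Dom" and \<psi>: "\<psi> \<in> ell2"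
  shows "cmod (ell2_inner \<phi> (H (P A \<psi>)) - of_real c * ell2_inner \<phi> (P A \<psi>))
    \<le> 2 * d * ((ell2_norm (P A \<phi>))\<^sup>2 + (ell2_norm (P A \<psi>))\<^sup>2)"
proof -
  note \<phi>' = domD(1)[OF \<phi>]
  have idem: "P A (P A \<eta>) = P A \<eta>" if "\<eta> \<in> ell2" for \<eta>
    using P_Int[OF A(1) A(1) that] by simp
  have in_dom: "P A \<eta> \<in> Dom" if "\<eta> \<in> ell2" for \<eta>
    by (rule localized_in_dom[OF A P_in_ell2[OF A(1) that] idem[OF that]])
  \<comment> \<open>The component of \<open>\<phi>\<close> orthogonal to the range of \<open>P A\<close>; it stays in the domain.\<close>
  define \<omega> where "\<omega> = (\<lambda>n. 1 * \<phi> n + (- 1) * P A \<phi> n)"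
  have "\<omega> \<in> Dom"
    unfolding \<omega>_def by (intro dom_lincomb \<phi> in_dom \<phi>')
  moreover have "P A \<omega> = (\<lambda>n. 0)"
    unfolding \<omega>_def P_lincomb[OF A(1) \<phi>' P_in_ell2[OF A(1) \<phi>']] idem[OF \<phi>'] by simp
  ultimately have "ell2_inner \<omega> (H (P A \<psi>)) = 0"
    by (intro form_vanishes_across[OF A(1) _ in_dom[OF \<psi>] idem[OF \<psi>]])
  then have "ell2_inner \<phi> (H (P A \<psi>)) = ell2_inner (P A \<phi>) (H (P A \<psi>))"
    using ell2_inner_lincomb_left[OF domD(2)[OF in_dom[OF \<psi>]] \<phi>' P_in_ell2[OF A(1) \<phi>'], of 1 "- 1"]
    by (simp add: \<omega>_def)
  moreover have "ell2_inner \<phi> (P A \<psi>) = ell2_inner (P A \<phi>) (P A \<psi>)"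
    using P_selfadjoint[OF A(1) \<phi>' P_in_ell2[OF A(1) \<psi>]] idem[OF \<psi>] by simp
  ultimately show ?thesis
    using form_bound_within[OF A P_in_ell2[OF A(1) \<phi>'] idem[OF \<phi>'] P_in_ell2[OF A(1) \<psi>] idem[OF \<psi>]]
    by simp
qed

section \<open>The Weyl solution\<close>

definition cell_part :: "nat \<Rightarrow> int \<Rightarrow> nat \<Rightarrow> complex" where
  "cell_part m j = P (mesh_cell m j) delta1"

lemma cell_part_in_ell2: "cell_part m j \<in> ell2"
  by (simp add: cell_part_def P_in_ell2 delta1_in_ell2)

lemma cell_part_norm: "(ell2_norm (cell_part m j))\<^sup>2 = measure (scalar_measure P delta1) (mesh_cell m j)"
  by (simp add: cell_part_def measure_scalar_measure delta1_in_ell2)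

lemma cell_part_1: "cell_part m j 1 = of_real (measure (scalar_measure P delta1) (mesh_cell m j))"
proof -
  have "cell_part m j 1 = ell2_inner delta1 (cell_part m j)"
    by (simp only: delta1_eq_site ell2_inner_site)
  also have "\<dots> = of_real ((ell2_norm (cell_part m j))\<^sup>2)"
    unfolding cell_part_def by (intro inner_P_eq_norm borel_mesh_cell delta1_in_ell2)
  finally show ?thesis
    by (simp only: cell_part_norm)
qed

lemma cell_part_orthogonal:
  assumes "i \<noteq> j"
  shows "ell2_inner (cell_part m i) (cell_part m j) = 0"
proof -
  have "ell2_inner (cell_part m i) (cell_part m j)
      = ell2_inner delta1 (P (mesh_cell m i) (cell_part m j))"
    unfolding cell_part_def
    by (intro P_selfadjoint[symmetric] P_in_ell2 delta1_in_ell2 borel_mesh_cell)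
  also have "P (mesh_cell m i) (cell_part m j) = (\<lambda>n. 0)"
    using assms by (simp add: cell_part_def P_Int delta1_in_ell2 mesh_cell_disjoint P_empty)
  finally show ?thesis by (simp add: ell2_inner_def)
qed

lemma mesh_mass_le:
  assumes "\<psi> \<in> ell2"
  shows "(\<Sum>j\<in>mesh_indices m. (ell2_norm (P (mesh_cell m j) \<psi>))\<^sup>2) \<le> (ell2_norm \<psi>)\<^sup>2"
proof -
  interpret finite_measure "scalar_measure P \<psi>"
    by (rule finite_scalar_measure[OF assms])
  have "(\<Sum>j\<in>mesh_indices m. (ell2_norm (P (mesh_cell m j) \<psi>))\<^sup>2)
      = (\<Sum>j\<in>mesh_indices m. measure (scalar_measure P \<psi>) (mesh_cell m j))"
    using assms by (simp add: measure_scalar_measure)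
  also have "\<dots> = measure (scalar_measure P \<psi>) (\<Union>j\<in>mesh_indices m. mesh_cell m j)"
    by (rule finite_measure_finite_Union[symmetric])
       (auto simp: disjoint_family_on_def mesh_cell_disjoint)
  also have "\<dots> \<le> measure (scalar_measure P \<psi>) UNIV"
    using bounded_measure[of "\<Union>j\<in>mesh_indices m. mesh_cell m j"] by simp
  also have "\<dots> = (ell2_norm \<psi>)\<^sup>2"
    using assms by (simp add: measure_scalar_measure P_UNIV)
  finally show ?thesis .
qed

text \<open>
  The pieces are orthogonal, so the squared norm of the remainder is 1 minus the mass of the covered
  cells.
\<close>

lemma mesh_remainder_tendsto_0:
  "(\<lambda>m. ell2_norm (\<lambda>n. delta1 n - (\<Sum>j\<in>mesh_indices m. cell_part m j n))) \<longlonglongrightarrow> 0"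
proof -
  let ?\<mu> = "scalar_measure P delta1"
  define s where "s m = (\<lambda>n. \<Sum>j\<in>mesh_indices m. 1 * cell_part m j n)" for m
  define r where "r m = (\<lambda>n. delta1 n - s m n)" for m
  define mass where "mass m = (\<Sum>j\<in>mesh_indices m. measure ?\<mu> (mesh_cell m j))" for m
  have s_in: "s m \<in> ell2" for m
    unfolding s_def by (intro ell2_sum finite_mesh_indices cell_part_in_ell2)
  have r_in: "r m \<in> ell2" for m
    unfolding r_def by (intro ell2_diff delta1_in_ell2 s_in)
  have norm1: "(ell2_norm delta1)\<^sup>2 = 1"
    by (simp add: delta1_eq_site ell2_norm_site)
  have cross: "ell2_inner delta1 (s m) = of_real (mass m)" for m
  proof -
    have "ell2_inner delta1 (s m) = s m 1"
      by (simp add: delta1_eq_site ell2_inner_site)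
    then show ?thesis by (simp add: s_def mass_def cell_part_1[unfolded One_nat_def])
  qed
  have self: "(ell2_norm (s m))\<^sup>2 = mass m" for m
    unfolding s_def mass_def
    by (subst ell2_norm_orthogonal_sum) (auto simp: cell_part_in_ell2 cell_part_orthogonal cell_part_norm)
  have norm_r: "(ell2_norm (r m))\<^sup>2 = 1 - mass m" for m
  proof -
    have "complex_of_real ((ell2_norm (r m))\<^sup>2) = ell2_inner (r m) (r m)"
      using ell2_inner_self[OF r_in] by simp
    also have "\<dots> = ell2_inner delta1 (r m) - ell2_inner (s m) (r m)"
      using ell2_inner_lincomb_left[OF r_in[of m] delta1_in_ell2 s_in[of m], of 1 "- 1"] by (simp add: r_def)
    also have "ell2_inner delta1 (r m) = 1 - of_real (mass m)"
      using ell2_inner_lincomb_right[OF delta1_in_ell2 delta1_in_ell2 s_in[of m], of 1 "- 1"]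
        ell2_inner_self[OF delta1_in_ell2] norm1 by (simp add: r_def cross)
    also have "ell2_inner (s m) (r m) = of_real (mass m) - of_real (mass m)"
      using ell2_inner_lincomb_right[OF s_in[of m] delta1_in_ell2 s_in[of m], of 1 "- 1"]
        ell2_inner_self[OF s_in, of m] self[of m]
        ell2_inner_commute[OF delta1_in_ell2 s_in, of m] by (simp add: r_def cross)
    finally have "complex_of_real ((ell2_norm (r m))\<^sup>2) = of_real (1 - mass m)"
      by simp
    then show ?thesis by (rule of_real_eq_iff[THEN iffD1])
  qed
  have "mass \<longlonglongrightarrow> (LINT x|?\<mu>. 1)"
    using mesh_sum_tendsto_integral[OF finite_scalar_measure[OF delta1_in_ell2], of "\<lambda>_. 1 :: real" 1]
    unfolding mass_def by simp
  also have "(LINT x|?\<mu>. 1) = (1 :: real)"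
    by (simp add: measure_scalar_measure delta1_in_ell2 P_UNIV norm1)
  finally have "(\<lambda>m. sqrt ((ell2_norm (r m))\<^sup>2)) \<longlonglongrightarrow> sqrt (1 - 1)"
    unfolding norm_r by (intro tendsto_intros)
  moreover have "sqrt ((ell2_norm (r m))\<^sup>2) = ell2_norm (r m)" for m
    using ell2_norm_nonneg[OF r_in] by simp
  ultimately show ?thesis
    by (simp add: r_def s_def)
qed

text \<open>
  The resolvent vector \<open>(H - z)\<^sup>-\<^sup>1 delta1\<close> is approximated by \<open>a m\<close>, the sum of
  \<open>(j / m - z)\<^sup>-\<^sup>1 P (mesh_cell m j) delta1\<close> over the mesh. Its entry at site 1 tends to \<open>F\<close>, its squared norm to
  the integral of \<open>1 / \<bar>x - z\<bar>\<^sup>2\<close>, which is \<open>Im F / \<epsilon>\<close>, and \<open>(H - z) (a m)\<close> tends to \<open>delta1\<close> at each site.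
  By the recursion all entries converge once those at 0 and 1 do, and the norm bound passes to finite
  sums of the limit.

  In the limit the source \<open>delta1\<close> is traded for the boundary value \<open>w 0 = - 1\<close>: this makes \<open>w\<close> a
  solution of the homogeneous equation at every site \<open>n \<ge> 1\<close>.
\<close>

lemma weyl_solution:
  fixes E \<epsilon> :: real
  assumes \<epsilon>: "\<epsilon> > 0"
  defines "z \<equiv> Complex E \<epsilon>"
  defines "F \<equiv> borel_transform (scalar_measure P delta1) z"
  obtains w :: "nat \<Rightarrow> complex" where "w 0 = - 1" and "w 1 = F"
    and "\<And>n. n \<ge> 1 \<Longrightarrow> w (n - 1) + w (n + 1) + of_real (V n) * w n = z * w n"
    and "\<And>N. \<epsilon> * (\<Sum>n = 1..N. (cmod (w n))\<^sup>2) \<le> cmod F"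
proof -
  let ?\<mu> = "scalar_measure P delta1"
  interpret \<mu>: finite_measure ?\<mu>
    by (rule finite_scalar_measure[OF delta1_in_ell2])
  define g where "g x = 1 / (complex_of_real x - z)" for x
  have denom: "cmod (complex_of_real x - z) \<ge> \<epsilon>" for x
    using abs_Im_le_cmod[of "complex_of_real x - z"] \<epsilon> by (simp add: z_def)
  then have denom_ne: "complex_of_real x - z \<noteq> 0" for x
    using \<epsilon> by (metis norm_zero not_less)
  have g_bound: "cmod (g x) \<le> 1 / \<epsilon>" for x
    using denom[of x] \<epsilon> by (simp add: g_def norm_divide frac_le)
  have g_cont: "continuous_on UNIV g"
    unfolding g_def using denom_ne by (intro continuous_intros) auto
  have g_meas: "g \<in> borel_measurable ?\<mu>"
    using borel_measurable_continuous_onI[OF g_cont]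
      measurable_cong_sets[OF sets_scalar_measure refl] by blast
  have Im_g: "Im (g x) = \<epsilon> * (cmod (g x))\<^sup>2" for x
    by (simp add: g_def z_def Im_divide norm_divide power_divide cmod_power2)
  have F_eq: "F = (LINT x|?\<mu>. g x)"
    by (simp add: F_def borel_transform_def g_def)
  have Im_F: "Im F = \<epsilon> * (LINT x|?\<mu>. (cmod (g x))\<^sup>2)"
  proof -
    have "integrable ?\<mu> g"
      by (rule \<mu>.integrable_const_bound[where B = "1 / \<epsilon>"]) (use g_bound g_meas in auto)
    then show ?thesis
      by (simp add: F_eq integral_Im[symmetric] Im_g)
  qed

  define c where "c m j = of_int j / real m" for m j
  define a where "a m = (\<lambda>n. \<Sum>j\<in>mesh_indices m. g (c m j) * cell_part m j n)" for m
  have a_in: "a m \<in> ell2" for m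
    unfolding a_def by (intro ell2_sum finite_mesh_indices cell_part_in_ell2)
  have a_0: "a m 0 = 0" for m
    by (rule ell2_zero[OF a_in])
  have a_1: "(\<lambda>m. a m 1) \<longlonglongrightarrow> F"
    using mesh_sum_tendsto_integral[OF \<mu>.finite_measure_axioms sets_scalar_measure g_cont g_bound]
    unfolding F_eq a_def c_def cell_part_1 by (simp add: scaleR_conv_of_real mult.commute)
  have a_norm: "(\<lambda>m. (ell2_norm (a m))\<^sup>2) \<longlonglongrightarrow> (LINT x|?\<mu>. (cmod (g x))\<^sup>2)"
  proof -
    have "(\<lambda>m. \<Sum>j\<in>mesh_indices m. measure ?\<mu> (mesh_cell m j) *\<^sub>R (cmod (g (of_int j / real m)))\<^sup>2)
        \<longlonglongrightarrow> (LINT x|?\<mu>. (cmod (g x))\<^sup>2)"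
    proof (rule mesh_sum_tendsto_integral[OF \<mu>.finite_measure_axioms sets_scalar_measure])
      show "continuous_on UNIV (\<lambda>x. (cmod (g x))\<^sup>2)"
        by (intro continuous_intros g_cont)
      show "norm ((cmod (g x))\<^sup>2) \<le> (1 / \<epsilon>)\<^sup>2" for x
        using power_mono[OF g_bound[of x] norm_ge_zero, of 2] by simp
    qed
    moreover have "(ell2_norm (a m))\<^sup>2
        = (\<Sum>j\<in>mesh_indices m. measure ?\<mu> (mesh_cell m j) *\<^sub>R (cmod (g (of_int j / real m)))\<^sup>2)" for m
      unfolding a_def
      by (subst ell2_norm_orthogonal_sum)
         (auto simp: cell_part_in_ell2 cell_part_orthogonal cell_part_norm c_def mult.commute)
    ultimately show ?thesis by simp
  qed

  have residual: "(\<lambda>m. H (a m) n - z * a m n) \<longlonglongrightarrow> delta1 n" if n: "n \<ge> 1" for n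
  proof -
    let ?r = "\<lambda>m. \<lambda>n. delta1 n - (\<Sum>j\<in>mesh_indices m. cell_part m j n)"
    have r_in: "?r m \<in> ell2" for m
      using ell2_sum[of "mesh_indices m" "cell_part m" "\<lambda>_. 1"]
      by (intro ell2_diff delta1_in_ell2) (simp add: cell_part_in_ell2)
    have bound: "cmod (H (a m) n - z * a m n - delta1 n) \<le> ell2_norm (?r m) + 4 / \<epsilon> * (1 / real m)"
      if m: "m > 0" for m
    proof -
      have err: "cmod (H (cell_part m j) n - of_real (c m j) * cell_part m j n)
          \<le> 2 * (1 / real m) * ((ell2_norm (P (mesh_cell m j) (site n)))\<^sup>2 + (ell2_norm (P (mesh_cell m j) delta1))\<^sup>2)"
        for j
        using H_localized_bound[OF borel_mesh_cell mesh_cell_subset[OF m, of j] _ site_in_dom[OF n] delta1_in_ell2]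
        by (simp add: ell2_inner_site c_def cell_part_def)
      \<comment> \<open>Replacing \<open>H\<close> by the number \<open>c m j\<close> on the cell \<open>j\<close> cancels the factor \<open>g (c m j)\<close>.\<close>
      have "H (a m) n = (\<Sum>j\<in>mesh_indices m. g (c m j) * H (cell_part m j) n)"
        using n by (simp add: a_def schroedinger_def sum.distrib sum_distrib_left algebra_simps)
      then have "H (a m) n - z * a m n
          = (\<Sum>j\<in>mesh_indices m. g (c m j) * (H (cell_part m j) n - z * cell_part m j n))"
        by (simp add: a_def sum_distrib_left sum_subtractf right_diff_distrib mult.left_commute)
      also have "\<dots> = (\<Sum>j\<in>mesh_indices m. cell_part m j n
          + g (c m j) * (H (cell_part m j) n - of_real (c m j) * cell_part m j n))"
      proof (rule sum.cong[OF refl])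
        fix j
        have "g (c m j) * (of_real (c m j) - z) = 1"
          using denom_ne by (simp add: g_def)
        then have "cell_part m j n = g (c m j) * (of_real (c m j) - z) * cell_part m j n"
          by simp
        then show "g (c m j) * (H (cell_part m j) n - z * cell_part m j n) = cell_part m j n
            + g (c m j) * (H (cell_part m j) n - of_real (c m j) * cell_part m j n)"
          by (simp add: algebra_simps)
      qed
      finally have split: "H (a m) n - z * a m n - delta1 n = - ?r m n
          + (\<Sum>j\<in>mesh_indices m. g (c m j) * (H (cell_part m j) n - of_real (c m j) * cell_part m j n))"
        by (simp add: sum.distrib)
      have "cmod (H (a m) n - z * a m n - delta1 n) \<le> cmod (?r m n)
          + cmod (\<Sum>j\<in>mesh_indices m. g (c m j) * (H (cell_part m j) n - of_real (c m j) * cell_part m j n))"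
        unfolding split
        by (rule order_trans[OF norm_triangle_ineq]) (simp only: norm_minus_cancel order_refl)
      also have "cmod (?r m n) \<le> ell2_norm (?r m)"
        using ell2_entry_le[OF r_in] ell2_norm_nonneg[OF r_in] by (rule power2_le_imp_le)
      also have "cmod (\<Sum>j\<in>mesh_indices m. g (c m j) * (H (cell_part m j) n - of_real (c m j) * cell_part m j n))
          \<le> (\<Sum>j\<in>mesh_indices m. 1 / \<epsilon> * (2 * (1 / real m) *
              ((ell2_norm (P (mesh_cell m j) (site n)))\<^sup>2 + (ell2_norm (P (mesh_cell m j) delta1))\<^sup>2)))"
        using \<epsilon> by (intro sum_norm_le) (simp only: norm_mult, intro mult_mono g_bound err, simp_all)
      also have "\<dots> = 1 / \<epsilon> * (2 * (1 / real m)) *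
          ((\<Sum>j\<in>mesh_indices m. (ell2_norm (P (mesh_cell m j) (site n)))\<^sup>2)
           + (\<Sum>j\<in>mesh_indices m. (ell2_norm (P (mesh_cell m j) delta1))\<^sup>2))"
        by (simp only: sum_distrib_left sum.distrib[symmetric] mult.assoc)
      also have "\<dots> \<le> 1 / \<epsilon> * (2 * (1 / real m)) * (1 + 1)"
        using mesh_mass_le[OF site_in_ell2[OF n], of m] mesh_mass_le[OF delta1_in_ell2, of m] \<epsilon>
        by (intro mult_left_mono add_mono) (simp_all add: delta1_eq_site ell2_norm_site[OF n] ell2_norm_site[of 1, simplified])
      finally show ?thesis by simp
    qed
    have "\<forall>\<^sub>F m in sequentially. cmod (H (a m) n - z * a m n - delta1 n)
        \<le> ell2_norm (?r m) + 4 / \<epsilon> * (1 / real m)"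
      by (rule eventually_mono[OF eventually_gt_at_top[of 0]]) (rule bound)
    moreover
    have "(\<lambda>m. ell2_norm (?r m) + 4 / \<epsilon> * (1 / real m)) \<longlonglongrightarrow> 0 + 4 / \<epsilon> * 0"
      by (intro tendsto_intros mesh_remainder_tendsto_0 lim_1_over_n)
    then have "(\<lambda>m. ell2_norm (?r m) + 4 / \<epsilon> * (1 / real m)) \<longlonglongrightarrow> 0"
      by (simp only: mult_zero_right add_0_left)
    ultimately have "(\<lambda>m. H (a m) n - z * a m n - delta1 n) \<longlonglongrightarrow> 0"
      by (rule Lim_null_comparison)
    then show ?thesis
      by (rule LIM_zero_cancel)
  qed

  have step: "(\<lambda>m. a m (n + 2)) \<longlonglongrightarrow> delta1 (n + 1) + (z - of_real (V (n + 1))) * y - x"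
    if "(\<lambda>m. a m n) \<longlonglongrightarrow> x" "(\<lambda>m. a m (n + 1)) \<longlonglongrightarrow> y" for n x y
  proof -
    have "(\<lambda>m. H (a m) (n + 1) - z * a m (n + 1) + (z - of_real (V (n + 1))) * a m (n + 1) - a m n)
        \<longlonglongrightarrow> delta1 (n + 1) + (z - of_real (V (n + 1))) * y - x"
      by (intro tendsto_intros residual that) simp
    then show ?thesis
      by (simp add: schroedinger_def algebra_simps)
  qed
  have "\<exists>x. (\<lambda>m. a m n) \<longlonglongrightarrow> x" for n
  proof (induction n rule: induct_nat_012)
    case 0
    then show ?case by (auto simp: a_0)
  next
    case 1
    then show ?case using a_1 by auto
  next
    case (ge2 n)
    then show ?case using step[of n] by auto
  qed
  then obtain v where v: "\<And>n. (\<lambda>m. a m n) \<longlonglongrightarrow> v n"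
    by metis
  have v_0: "v 0 = 0"
    using v[of 0] LIMSEQ_unique by (simp add: a_0 LIMSEQ_const_iff)
  have v_1: "v 1 = F"
    using v[of 1] a_1 by (rule LIMSEQ_unique)
  have v_step: "v (n + 2) = delta1 (n + 1) + (z - of_real (V (n + 1))) * v (n + 1) - v n" for n
    by (rule LIMSEQ_unique[OF v step[OF v v]])
  have v_bound: "\<epsilon> * (\<Sum>n = 1..N. (cmod (v n))\<^sup>2) \<le> cmod F" for N
  proof -
    have "(\<lambda>m. \<Sum>n = 1..N. (cmod (a m n))\<^sup>2) \<longlonglongrightarrow> (\<Sum>n = 1..N. (cmod (v n))\<^sup>2)"
      by (intro tendsto_intros v)
    then have "(\<Sum>n = 1..N. (cmod (v n))\<^sup>2) \<le> (LINT x|?\<mu>. (cmod (g x))\<^sup>2)"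
      using a_norm sum_square_le_ell2_norm[OF a_in] by (intro LIMSEQ_le) auto
    then have "\<epsilon> * (\<Sum>n = 1..N. (cmod (v n))\<^sup>2) \<le> Im F"
      using \<epsilon> by (simp add: Im_F)
    also have "\<dots> \<le> cmod F"
      using abs_Im_le_cmod[of F] by linarith
    finally show ?thesis .
  qed
  \<comment> \<open>The source \<open>delta1 1\<close> in the equation at site 1 becomes \<open>- w 0\<close>.\<close>
  show ?thesis
  proof (rule that[of "v(0 := - 1)"])
    fix n :: nat assume "n \<ge> 1"
    then obtain k where k: "n = Suc k"
      by (cases n) auto
    show "(v(0 := - 1)) (n - 1) + (v(0 := - 1)) (n + 1) + of_real (V n) * (v(0 := - 1)) n = z * (v(0 := - 1)) n"
      using v_step[of k] v_0 by (cases k) (simp_all add: k delta1_def algebra_simps)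
  next
    show "\<epsilon> * (\<Sum>n = 1..N. (cmod ((v(0 := - 1)) n))\<^sup>2) \<le> cmod F" for N
      using v_bound[of N] by simp
  qed (use v_1 in simp_all)
qed

end

section \<open>Truncated norms\<close>

text \<open>
  The share with which site \<open>n\<close> enters the norm truncated at \<open>L\<close>: 1 up to \<open>L\<close>, the fractional part
  of \<open>L\<close> at the next site, 0 beyond.
\<close>

definition site_weight :: "real \<Rightarrow> nat \<Rightarrow> real" where
  "site_weight L n = min 1 (max 0 (L - real n + 1))"

text \<open>
  For \<open>0 \<le> L \<le> N\<close> this is \<open>norm_upto\<close>, written as one Euclidean norm over an index set that does
  not depend on \<open>L\<close>. This makes continuity and monotonicity in \<open>L\<close>, the triangle inequality and
  Cauchy-Schwarz directly available.
\<close>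

definition truncated_norm :: "nat \<Rightarrow> (nat \<Rightarrow> real) \<Rightarrow> real \<Rightarrow> real" where
  "truncated_norm N u L = L2_set (\<lambda>n. sqrt (site_weight L n) * u n) {1..N}"

lemma site_weight_nonneg [simp]: "site_weight L n \<ge> 0"
  by (simp add: site_weight_def)

lemma site_weight_le_1 [simp]: "site_weight L n \<le> 1"
  by (simp add: site_weight_def)

lemma truncated_norm_square:
  "(truncated_norm N u L)\<^sup>2 = (\<Sum>n = 1..N. site_weight L n * (u n)\<^sup>2)"
  by (simp add: truncated_norm_def L2_set_def sum_nonneg power_mult_distrib)

lemma norm_upto_eq_truncated_norm:
  assumes "0 \<le> L" "L \<le> real N"
  shows "norm_upto u L = truncated_norm N u L"
proof -
  define M where "M = nat \<lfloor>L\<rfloor>"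
  have M: "real M \<le> L" "L < real M + 1" "of_int \<lfloor>L\<rfloor> = real M"
    using assms by (auto simp: M_def)
  define a where "a = (\<lambda>n. site_weight L n * (u n)\<^sup>2)"
  have a_low: "a n = \<bar>u n\<bar>\<^sup>2" if "n \<in> {1..M}" for n
    using that M by (simp add: a_def site_weight_def)
  have a_top: "a (M + 1) = (L - M) * \<bar>u (M + 1)\<bar>\<^sup>2"
    using M by (simp add: a_def site_weight_def)
  have a_high: "a n = 0" if "n > M + 1" for n
    using that M by (simp add: a_def site_weight_def)
  have "(\<Sum>n = 1..N. a n) = (\<Sum>n = 1..M + 1. a n)"
  proof (cases "N \<ge> M + 1")
    case True
    then show ?thesis
      by (intro sum.mono_neutral_right) (auto intro!: a_high)
  next
    case False
    then have "N = M" "a (M + 1) = 0"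
      using M assms a_top by auto
    then show ?thesis by simp
  qed
  also have "\<dots> = (\<Sum>n = 1..M. \<bar>u n\<bar>\<^sup>2) + (L - M) * \<bar>u (M + 1)\<bar>\<^sup>2"
    using a_top by (simp add: a_low cong: sum.cong_simp)
  finally have "(\<Sum>n = 1..M. \<bar>u n\<bar>\<^sup>2) + (L - M) * \<bar>u (M + 1)\<bar>\<^sup>2 = (truncated_norm N u L)\<^sup>2"
    by (simp add: truncated_norm_square a_def)
  then show ?thesis
    using M by (simp add: norm_upto_def M_def[symmetric] truncated_norm_def L2_set_nonneg)
qed

lemma site_weight_mono: "L \<le> L' \<Longrightarrow> site_weight L n \<le> site_weight L' n"
  by (auto simp: site_weight_def)

lemma norm_upto_nonneg: "0 \<le> L \<Longrightarrow> 0 \<le> norm_upto u L"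
  using norm_upto_eq_truncated_norm[of L "nat \<lceil>L\<rceil>" u]
  by (simp add: truncated_norm_def L2_set_nonneg)

lemma norm_upto_mono:
  assumes "0 \<le> L" "L \<le> L'"
  shows "norm_upto u L \<le> norm_upto u L'"
proof -
  obtain N :: nat where N: "L' \<le> real N"
    using real_arch_simple by blast
  have "truncated_norm N u L \<le> truncated_norm N u L'"
    unfolding truncated_norm_def L2_set_def
    using assms
    by (intro real_sqrt_le_mono sum_mono) (auto simp: power_mult_distrib site_weight_mono intro!: mult_right_mono)
  then show ?thesis
    using assms N by (simp add: norm_upto_eq_truncated_norm[where N = N])
qed

lemma continuous_on_norm_upto: "continuous_on {0..R} (norm_upto u)"
proof -
  obtain N :: nat where N: "R \<le> real N"
    using real_arch_simple by blast
  have "continuous_on {0..R} (truncated_norm N u)"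
    unfolding truncated_norm_def L2_set_def site_weight_def by (intro continuous_intros)
  then show ?thesis
    by (rule continuous_on_eq) (use N in \<open>simp add: norm_upto_eq_truncated_norm[where N = N]\<close>)
qed

section \<open>The Jitomirskaya--Last inequality\<close>

locale solution_pair =
  fixes V :: "nat \<Rightarrow> real" and E :: real and u1 u2 :: "nat \<Rightarrow> real"
  assumes eq1: "eigen_equation V E u1" and u1_0: "u1 0 = 0" and u1_1: "u1 1 = 1"
    and eq2: "eigen_equation V E u2" and u2_0: "u2 0 = 1" and u2_1: "u2 1 = 0"
begin

lemma u1_Suc: "u1 (Suc (Suc n)) = (E - V (Suc n)) * u1 (Suc n) - u1 n"
  using eq1 by (auto simp: eigen_equation_def algebra_simps dest: spec[of _ "Suc n"])

lemma u2_Suc: "u2 (Suc (Suc n)) = (E - V (Suc n)) * u2 (Suc n) - u2 n"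
  using eq2 by (auto simp: eigen_equation_def algebra_simps dest: spec[of _ "Suc n"])

lemma wronskian: "u1 (Suc n) * u2 n - u1 n * u2 (Suc n) = 1"
proof (induction n)
  case 0
  then show ?case using u1_0 u1_1 u2_0 u2_1 by simp
next
  case (Suc n)
  then show ?case by (simp add: u1_Suc u2_Suc algebra_simps)
qed

text \<open>
  The solution \<open>w\<close> at energy \<open>E + \<i> * \<epsilon>\<close> satisfies the equation at energy \<open>E\<close> with source
  \<open>\<i> * \<epsilon> * w\<close>. The kernel \<open>u1 n * u2 k - u2 n * u1 k\<close> solves the equation at \<open>E\<close> in \<open>n\<close>, vanishes at
  \<open>n = k\<close>, and is 1 at \<open>n = k + 1\<close> by the Wronskian identity.
\<close>

lemma variation_of_parameters:
  fixes w :: "nat \<Rightarrow> complex"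
  assumes eq: "\<And>n. n \<ge> 1 \<Longrightarrow> w (n - 1) + w (n + 1) + of_real (V n) * w n = Complex E \<epsilon> * w n"
    and w0: "w 0 = - 1"
  shows "w n = w 1 * of_real (u1 n) - of_real (u2 n)
    + \<i> * of_real \<epsilon> * (\<Sum>k = 1..<n. of_real (u1 n * u2 k - u2 n * u1 k) * w k)"
proof -
  define A where "A n = (\<Sum>k = 1..<n. of_real (u2 k) * w k)" for n
  define B where "B n = (\<Sum>k = 1..<n. of_real (u1 k) * w k)" for n
  define c where "c = \<i> * of_real \<epsilon>"
  have w_Suc: "w (Suc (Suc n)) = (of_real (E - V (Suc n)) + c) * w (Suc n) - w n" for n
    using eq[of "Suc n"] by (simp add: complex_eq_iff c_def) (auto simp: algebra_simps)
  have A_Suc: "A (Suc (Suc n)) = A (Suc n) + of_real (u2 (Suc n)) * w (Suc n)"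
    and B_Suc: "B (Suc (Suc n)) = B (Suc n) + of_real (u1 (Suc n)) * w (Suc n)" for n
    by (simp_all add: A_def B_def)
  have W: "complex_of_real (u1 (Suc n)) * of_real (u2 n) - of_real (u1 n) * of_real (u2 (Suc n)) = 1" for n
    using arg_cong[OF wronskian[of n], of complex_of_real] by simp
  have closed: "w n = w 1 * of_real (u1 n) - of_real (u2 n)
      + c * (of_real (u1 n) * A n - of_real (u2 n) * B n)" for n
  proof (induction n rule: induct_nat_012)
    case 0
    then show ?case using w0 u1_0 u2_0 by (simp add: A_def B_def)
  next
    case 1
    then show ?case using u1_1 u2_1 by (simp add: A_def B_def)
  next
    case (ge2 n)
    \<comment> \<open>The last summand of \<open>A (Suc n)\<close> and \<open>B (Suc n)\<close> cancels at \<open>n\<close>, where the kernel vanishes.\<close>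
    have IH: "w n = w 1 * of_real (u1 n) - of_real (u2 n)
        + c * (of_real (u1 n) * A (Suc n) - of_real (u2 n) * B (Suc n))"
      using ge2(1) by (cases n) (simp_all add: A_def B_def algebra_simps)
    define a b a' b' e where "a = complex_of_real (u1 n)" and "b = complex_of_real (u2 n)"
      and "a' = complex_of_real (u1 (Suc n))" and "b' = complex_of_real (u2 (Suc n))"
      and "e = complex_of_real (E - V (Suc n))"
    note folds = a_def[symmetric] b_def[symmetric] a'_def[symmetric] b'_def[symmetric] e_def[symmetric]
    have u_Suc: "complex_of_real (u1 (Suc (Suc n))) = e * a' - a"
      "complex_of_real (u2 (Suc (Suc n))) = e * b' - b"
      by (simp_all only: u1_Suc u2_Suc of_real_mult of_real_diff[of "_ * _"] folds)
    have W': "a' * b - a * b' = 1"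
      using W[of n] by (simp only: folds)
    have "w (Suc (Suc n)) = e * w (Suc n) - w n + (a' * b - a * b') * (c * w (Suc n))"
      unfolding w_Suc W' e_def by (simp add: algebra_simps)
    also have "e * w (Suc n) = e * (w 1 * a' - b' + c * (a' * A (Suc n) - b' * B (Suc n)))"
      using ge2(2) by (simp only: folds)
    also have "w n = w 1 * a - b + c * (a * A (Suc n) - b * B (Suc n))"
      using IH by (simp only: folds)
    finally show ?case
      unfolding u_Suc A_Suc B_Suc folds by (simp add: algebra_simps)
  qed
  show ?thesis
    by (subst closed) (simp add: A_def B_def c_def sum_distrib_left sum_subtractf algebra_simps)
qed

text \<open>
  Cauchy-Schwarz in \<open>k\<close> bounds \<open>d n\<close> by \<open>\<epsilon> * W\<close> times \<open>\<bar>u1 n\<bar> * b + \<bar>u2 n\<bar> * a\<close>; taking the norm in \<open>n\<close>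
  turns each of the two summands into \<open>a * b\<close>.
\<close>

lemma truncated_duhamel_bound:
  fixes w :: "nat \<Rightarrow> complex" and N :: nat and L \<epsilon> :: real
  defines "W \<equiv> truncated_norm N (\<lambda>n. cmod (w n)) L"
    and "a \<equiv> truncated_norm N u1 L" and "b \<equiv> truncated_norm N u2 L"
  assumes "\<epsilon> > 0"
    and d: "\<And>n. d n = cmod (\<i> * of_real \<epsilon> * (\<Sum>k = 1..<n. of_real (u1 n * u2 k - u2 n * u1 k) * w k))"
  shows "truncated_norm N d L \<le> 2 * \<epsilon> * a * b * W"
proof -
  let ?s = "\<lambda>n. sqrt (site_weight L n)"
  have CS: "?s n * (\<Sum>k = 1..<n. \<bar>u k\<bar> * cmod (w k)) \<le> ?s n * (truncated_norm N u L * W)"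
    if "n \<in> {1..N}" for n u
  proof (cases "site_weight L n = 0")
    case False
    \<comment> \<open>A site of positive weight is preceded only by sites of full weight.\<close>
    then have full: "site_weight L k = 1" if "k \<in> {1..<n}" for k
      using that by (auto simp: site_weight_def min_def max_def split: if_splits)
    have "(\<Sum>k = 1..<n. \<bar>u k\<bar> * cmod (w k))
        = (\<Sum>k = 1..<n. \<bar>?s k * u k\<bar> * \<bar>?s k * cmod (w k)\<bar>)"
      using full by simp
    also have "\<dots> \<le> (\<Sum>k = 1..N. \<bar>?s k * u k\<bar> * \<bar>?s k * cmod (w k)\<bar>)"
      using that by (intro sum_mono2) auto
    also have "\<dots> \<le> truncated_norm N u L * W"
      unfolding truncated_norm_def W_def by (rule L2_set_mult_ineq)
    finally show ?thesis
      by (intro mult_left_mono) auto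
  qed simp
  have nonneg: "a \<ge> 0" "b \<ge> 0" "W \<ge> 0"
    by (simp_all add: a_def b_def W_def truncated_norm_def L2_set_nonneg)
  have pointwise: "?s n * d n \<le> \<epsilon> * W * b * (?s n * \<bar>u1 n\<bar>) + \<epsilon> * W * a * (?s n * \<bar>u2 n\<bar>)"
    if n: "n \<in> {1..N}" for n
  proof -
    have "d n = \<epsilon> * cmod (\<Sum>k = 1..<n. of_real (u1 n * u2 k - u2 n * u1 k) * w k)"
      using \<open>\<epsilon> > 0\<close> by (simp add: d norm_mult)
    also have "\<dots> \<le> \<epsilon> * (\<Sum>k = 1..<n. \<bar>u1 n\<bar> * (\<bar>u2 k\<bar> * cmod (w k)) + \<bar>u2 n\<bar> * (\<bar>u1 k\<bar> * cmod (w k)))"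
    proof (intro mult_left_mono sum_norm_le)
      fix k
      have "\<bar>u1 n * u2 k - u2 n * u1 k\<bar> \<le> \<bar>u1 n\<bar> * \<bar>u2 k\<bar> + \<bar>u2 n\<bar> * \<bar>u1 k\<bar>"
        using abs_triangle_ineq4[of "u1 n * u2 k" "u2 n * u1 k"] by (simp add: abs_mult)
      then have "\<bar>u1 n * u2 k - u2 n * u1 k\<bar> * cmod (w k) \<le> (\<bar>u1 n\<bar> * \<bar>u2 k\<bar> + \<bar>u2 n\<bar> * \<bar>u1 k\<bar>) * cmod (w k)"
        by (rule mult_right_mono) simp
      then show "norm (of_real (u1 n * u2 k - u2 n * u1 k) * w k)
          \<le> \<bar>u1 n\<bar> * (\<bar>u2 k\<bar> * cmod (w k)) + \<bar>u2 n\<bar> * (\<bar>u1 k\<bar> * cmod (w k))"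
        by (simp add: norm_mult algebra_simps del: of_real_mult of_real_diff)
    qed (use \<open>\<epsilon> > 0\<close> in simp)
    also have "\<dots> = \<epsilon> * (\<bar>u1 n\<bar> * (\<Sum>k = 1..<n. \<bar>u2 k\<bar> * cmod (w k)) + \<bar>u2 n\<bar> * (\<Sum>k = 1..<n. \<bar>u1 k\<bar> * cmod (w k)))"
      by (simp add: sum.distrib sum_distrib_left)
    finally have "?s n * d n \<le> ?s n * (\<epsilon> * (\<bar>u1 n\<bar> * (\<Sum>k = 1..<n. \<bar>u2 k\<bar> * cmod (w k)) + \<bar>u2 n\<bar> * (\<Sum>k = 1..<n. \<bar>u1 k\<bar> * cmod (w k))))"
      by (rule mult_left_mono) simp
    also have "\<dots> = \<epsilon> * (\<bar>u1 n\<bar> * (?s n * (\<Sum>k = 1..<n. \<bar>u2 k\<bar> * cmod (w k))) + \<bar>u2 n\<bar> * (?s n * (\<Sum>k = 1..<n. \<bar>u1 k\<bar> * cmod (w k))))"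
      by (simp only: distrib_left mult.left_commute)
    also have "\<dots> \<le> \<epsilon> * (\<bar>u1 n\<bar> * (?s n * (b * W)) + \<bar>u2 n\<bar> * (?s n * (a * W)))"
      unfolding a_def b_def using \<open>\<epsilon> > 0\<close>
      by (intro mult_left_mono[of _ _ \<epsilon>] add_mono mult_left_mono[OF CS[OF n] abs_ge_zero]) simp
    finally show ?thesis
      by (simp add: algebra_simps)
  qed
  have "truncated_norm N d L \<le> L2_set (\<lambda>n. \<epsilon> * W * b * (?s n * \<bar>u1 n\<bar>) + \<epsilon> * W * a * (?s n * \<bar>u2 n\<bar>)) {1..N}"
    unfolding truncated_norm_def by (rule L2_set_mono) (use pointwise in \<open>auto simp: d\<close>)
  also have "\<dots> \<le> L2_set (\<lambda>n. \<epsilon> * W * b * (?s n * \<bar>u1 n\<bar>)) {1..N} + L2_set (\<lambda>n. \<epsilon> * W * a * (?s n * \<bar>u2 n\<bar>)) {1..N}"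
    by (rule L2_set_triangle_ineq)
  also have "\<dots> = \<epsilon> * W * b * L2_set (\<lambda>n. ?s n * \<bar>u1 n\<bar>) {1..N} + \<epsilon> * W * a * L2_set (\<lambda>n. ?s n * \<bar>u2 n\<bar>) {1..N}"
    using nonneg \<open>\<epsilon> > 0\<close> by (simp add: L2_set_right_distrib)
  also have "\<dots> = 2 * \<epsilon> * a * b * W"
    by (simp add: a_def b_def truncated_norm_def L2_set_def power_mult_distrib)
  finally show ?thesis .
qed

text \<open>
  At the scale where \<open>\<epsilon>\<close> times the two norms is 1, the Duhamel term has at most twice the norm \<open>W\<close> of \<open>w\<close>,
  so \<open>w 1 * u1 - u2\<close> has norm at most \<open>3 * W\<close>. Its norm is at least the difference of the norms of its two
  terms, while \<open>bound\<close> gives \<open>W\<^sup>2 \<le> cmod (w 1) / \<epsilon>\<close>. Another constant than 1 for the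
  scale would only change the factor 9; with the value 1 the argument of \<open>\<rho>\<close> in the criterion is exactly
  \<open>\<epsilon>\<close>, and \<open>\<rho>\<close> is compared with itself at one and the same point.
\<close>

lemma Jitomirskaya_Last:
  fixes w :: "nat \<Rightarrow> complex"
  assumes eq: "\<And>n. n \<ge> 1 \<Longrightarrow> w (n - 1) + w (n + 1) + of_real (V n) * w n = Complex E \<epsilon> * w n"
    and w0: "w 0 = - 1"
    and bound: "\<And>N. \<epsilon> * (\<Sum>n = 1..N. (cmod (w n))\<^sup>2) \<le> cmod (w 1)"
    and \<epsilon>: "\<epsilon> > 0" and L: "L \<ge> 0"
    and scale: "\<epsilon> * norm_upto u1 L * norm_upto u2 L = 1"
  shows "(cmod (w 1) * norm_upto u1 L - norm_upto u2 L)\<^sup>2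
    \<le> 9 * (cmod (w 1) * norm_upto u1 L * norm_upto u2 L)"
proof -
  obtain N :: nat where N: "L \<le> real N"
    using real_arch_simple by blast
  define a b where "a = norm_upto u1 L" and "b = norm_upto u2 L"
  have ab: "a = truncated_norm N u1 L" "b = truncated_norm N u2 L"
    using L N by (simp_all add: a_def b_def norm_upto_eq_truncated_norm[where N = N])
  define W where "W = truncated_norm N (\<lambda>n. cmod (w n)) L"
  define m where "m = cmod (w 1)"
  let ?s = "\<lambda>n. sqrt (site_weight L n)"
  define d where "d n = cmod (\<i> * of_real \<epsilon> * (\<Sum>k = 1..<n. of_real (u1 n * u2 k - u2 n * u1 k) * w k))" for n
  have scale': "\<epsilon> * a * b = 1"
    using scale by (simp add: a_def b_def)
  have "truncated_norm N d L \<le> 2 * \<epsilon> * a * b * W"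
    unfolding W_def ab by (rule truncated_duhamel_bound) (simp_all add: \<epsilon> d_def)
  also have "2 * \<epsilon> * a * b * W = 2 * (\<epsilon> * a * b) * W"
    by (simp only: ac_simps)
  finally have D: "truncated_norm N d L \<le> 2 * W"
    by (simp add: scale')
  have nonneg: "a \<ge> 0" "b \<ge> 0" "W \<ge> 0" "m \<ge> 0"
    by (simp_all add: ab W_def m_def truncated_norm_def L2_set_nonneg)
  have sub: "\<bar>m * \<bar>u1 n\<bar> - \<bar>u2 n\<bar>\<bar> \<le> cmod (w n) + d n" for n
  proof -
    let ?y = "w 1 * of_real (u1 n) - of_real (u2 n)"
    let ?r = "\<i> * of_real \<epsilon> * (\<Sum>k = 1..<n. of_real (u1 n * u2 k - u2 n * u1 k) * w k)"
    have "\<bar>m * \<bar>u1 n\<bar> - \<bar>u2 n\<bar>\<bar> \<le> cmod ?y"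
      using norm_triangle_ineq3[of "w 1 * of_real (u1 n)" "of_real (u2 n)"]
      by (simp add: m_def norm_mult)
    also have "?y = w n - ?r"
      using variation_of_parameters[OF eq w0, of n] by (simp add: algebra_simps)
    also have "cmod \<dots> \<le> cmod (w n) + d n"
      unfolding d_def by (rule norm_triangle_ineq4)
    finally show ?thesis .
  qed
  have wd: "L2_set (\<lambda>n. ?s n * cmod (w n) + ?s n * d n) {1..N} \<le> 3 * W"
    using L2_set_triangle_ineq[of "\<lambda>n. ?s n * cmod (w n)" "\<lambda>n. ?s n * d n" "{1..N}"] D
    by (simp add: W_def truncated_norm_def)
  have abs_norm: "truncated_norm N u L = L2_set (\<lambda>n. ?s n * \<bar>u n\<bar>) {1..N}" for u
    by (simp add: truncated_norm_def L2_set_def power_mult_distrib)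
  have d_nonneg: "d n \<ge> 0" for n
    by (simp add: d_def)
  have upper: "m * a \<le> b + 3 * W"
  proof -
    have "m * a = L2_set (\<lambda>n. m * (?s n * \<bar>u1 n\<bar>)) {1..N}"
      using nonneg by (simp add: ab abs_norm L2_set_right_distrib)
    also have "\<dots> \<le> L2_set (\<lambda>n. ?s n * \<bar>u2 n\<bar> + (?s n * cmod (w n) + ?s n * d n)) {1..N}"
    proof (rule L2_set_mono)
      fix n
      have "?s n * (m * \<bar>u1 n\<bar>) \<le> ?s n * (\<bar>u2 n\<bar> + (cmod (w n) + d n))"
        using sub[of n] by (intro mult_left_mono) auto
      then show "m * (?s n * \<bar>u1 n\<bar>) \<le> ?s n * \<bar>u2 n\<bar> + (?s n * cmod (w n) + ?s n * d n)"
        by (simp add: algebra_simps)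
    qed (use nonneg in auto)
    also have "\<dots> \<le> b + 3 * W"
      using L2_set_triangle_ineq[of "\<lambda>n. ?s n * \<bar>u2 n\<bar>" "\<lambda>n. ?s n * cmod (w n) + ?s n * d n" "{1..N}"] wd
      by (simp add: ab abs_norm)
    finally show ?thesis .
  qed
  have lower: "b \<le> m * a + 3 * W"
  proof -
    have "b \<le> L2_set (\<lambda>n. m * (?s n * \<bar>u1 n\<bar>) + (?s n * cmod (w n) + ?s n * d n)) {1..N}"
      unfolding ab abs_norm
    proof (rule L2_set_mono)
      fix n
      have "?s n * \<bar>u2 n\<bar> \<le> ?s n * (m * \<bar>u1 n\<bar> + (cmod (w n) + d n))"
        using sub[of n] by (intro mult_left_mono) auto
      then show "?s n * \<bar>u2 n\<bar> \<le> m * (?s n * \<bar>u1 n\<bar>) + (?s n * cmod (w n) + ?s n * d n)"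
        by (simp add: algebra_simps)
    qed auto
    also have "\<dots> \<le> L2_set (\<lambda>n. m * (?s n * \<bar>u1 n\<bar>)) {1..N} + 3 * W"
      using L2_set_triangle_ineq[of "\<lambda>n. m * (?s n * \<bar>u1 n\<bar>)" "\<lambda>n. ?s n * cmod (w n) + ?s n * d n" "{1..N}"] wd
      by simp
    also have "\<dots> = m * a + 3 * W"
      using nonneg by (simp add: ab abs_norm L2_set_right_distrib)
    finally show ?thesis .
  qed
  have "W\<^sup>2 \<le> (\<Sum>n = 1..N. (cmod (w n))\<^sup>2)"
    unfolding W_def truncated_norm_square
    by (intro sum_mono mult_left_le_one_le) auto
  then have "\<epsilon> * W\<^sup>2 \<le> m"
    using bound[of N] \<epsilon> unfolding m_def by (meson mult_left_mono less_imp_le order_trans)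
  then have "a * b * (\<epsilon> * W\<^sup>2) \<le> a * b * m"
    using nonneg by (intro mult_left_mono) auto
  also have "a * b * (\<epsilon> * W\<^sup>2) = (\<epsilon> * a * b) * W\<^sup>2"
    by (simp only: ac_simps)
  finally have "W\<^sup>2 \<le> m * a * b"
    unfolding scale' by (simp add: mult.commute mult.left_commute)
  have "(m * a - b)\<^sup>2 \<le> (3 * W)\<^sup>2"
    using upper lower nonneg by (intro abs_le_square_iff[THEN iffD1]) auto
  also have "\<dots> \<le> 9 * (m * a * b)"
    using \<open>W\<^sup>2 \<le> m * a * b\<close> by (simp add: power_mult_distrib)
  finally show ?thesis
    by (simp add: m_def a_def b_def)
qed

text \<open>
  With \<open>r = m * a / b\<close> the hypothesis reads \<open>r + 1 / r \<le> 11\<close>, which bounds \<open>r\<close> from both sides.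
\<close>

lemma Jitomirskaya_Last_ratio:
  fixes m a b :: real
  assumes "(m * a - b)\<^sup>2 \<le> 9 * (m * a * b)" "m \<ge> 0" "a > 0" "b > 0"
  shows "m * a \<le> 11 * b" and "b \<le> 11 * (m * a)"
proof -
  have main: "x \<le> 11 * y" if "(x - y)\<^sup>2 \<le> 9 * (x * y)" "y > 0" for x y :: real
  proof (rule ccontr)
    assume "\<not> x \<le> 11 * y"
    then have "x * (11 * y) < x * x" using that by (intro mult_strict_left_mono) auto
    moreover have "y * y > 0" using that by simp
    moreover have "x * x + y * y \<le> x * (11 * y)"
      using that(1) by (simp add: power2_eq_square algebra_simps)
    ultimately show False by linarith
  qed
  have "m * a > 0"
  proof (rule ccontr)
    assume "\<not> m * a > 0"
    then have "m * a = 0" using assms by (simp add: less_le)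
    then show False using assms by simp
  qed
  then show "m * a \<le> 11 * b" "b \<le> 11 * (m * a)"
    using main[of "m * a" b] main[of b "m * a"] assms
    by (simp_all add: power2_commute mult.commute)
qed

end

section \<open>Upper and lower limits along a change of scale\<close>

text \<open>
  A continuous \<open>s\<close> tending to 0 takes, beyond any \<open>R\<close>, every value between 0 and \<open>s R\<close>; so small
  values of \<open>\<epsilon>\<close> with \<open>Q \<epsilon>\<close> are attained at arbitrarily large arguments.
\<close>

lemma frequently_at_right_0_iff_at_top:
  fixes s :: "real \<Rightarrow> real"
  assumes cont: "\<And>R. continuous_on {L0..R} s"
    and lim: "filterlim s (at_right 0) at_top"
  shows "(\<exists>\<^sub>F \<epsilon> in at_right 0. Q \<epsilon>) \<longleftrightarrow> (\<exists>\<^sub>F L in at_top. Q (s L))"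
proof
  assume "\<exists>\<^sub>F L in at_top. Q (s L)"
  then show "\<exists>\<^sub>F \<epsilon> in at_right 0. Q \<epsilon>"
    using lim unfolding frequently_def filterlim_iff by blast
next
  assume Q: "\<exists>\<^sub>F \<epsilon> in at_right 0. Q \<epsilon>"
  have pos: "\<forall>\<^sub>F L in at_top. s L > 0"
    using lim by (auto simp: filterlim_at elim: eventually_mono)
  have tends: "(s \<longlongrightarrow> 0) at_top"
    using lim by (simp add: filterlim_at)
  show "\<exists>\<^sub>F L in at_top. Q (s L)"
    unfolding frequently_def eventually_at_top_linorder
  proof
    assume "\<exists>L1. \<forall>L\<ge>L1. \<not> Q (s L)"
    then obtain L1 where L1: "\<And>L. L \<ge> L1 \<Longrightarrow> \<not> Q (s L)"
      by blast
    \<comment> \<open>A value \<open>\<epsilon> < s R\<close> with \<open>Q \<epsilon>\<close> is attained beyond \<open>R\<close>, hence beyond \<open>L1\<close>.\<close>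
    obtain R where R: "R > max L0 L1" "s R > 0"
      using eventually_happens'[OF trivial_limit_at_top_linorder
          eventually_conj[OF pos eventually_gt_at_top[of "max L0 L1"]]] by blast
    have "\<exists>\<^sub>F \<epsilon> in at_right 0. Q \<epsilon> \<and> 0 < \<epsilon> \<and> \<epsilon> < s R"
      by (rule frequently_rev_mp[OF Q])
         (use eventually_at_right_real[OF R(2)] in \<open>auto elim: eventually_mono\<close>)
    then obtain \<epsilon> where \<epsilon>: "Q \<epsilon>" "0 < \<epsilon>" "\<epsilon> < s R"
      using frequently_ex by blast
    obtain R' where R': "R' \<ge> R" "s R' < \<epsilon>"
      using eventually_happens'[OF trivial_limit_at_top_linorder
          eventually_conj[OF order_tendstoD(2)[OF tends \<epsilon>(2)] eventually_ge_at_top[of R]]] by blast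
    obtain L where "R \<le> L" "L \<le> R'" "s L = \<epsilon>"
      using IVT2'[of s R' \<epsilon> R] R' \<epsilon> R continuous_on_subset[OF cont[of R'], of "{R..R'}"] by auto
    then show False
      using L1[of L] \<epsilon> R by simp
  qed
qed

lemma Limsup_eq_PInfty_iff:
  fixes f :: "'a \<Rightarrow> real"
  shows "Limsup F (\<lambda>x. ereal (f x)) = \<infinity> \<longleftrightarrow> (\<forall>K>0. \<exists>\<^sub>F x in F. f x > K)"
proof
  assume inf: "Limsup F (\<lambda>x. ereal (f x)) = \<infinity>"
  show "\<forall>K>0. \<exists>\<^sub>F x in F. f x > K"
  proof (intro allI impI, rule ccontr)
    fix K :: real assume "\<not> (\<exists>\<^sub>F x in F. f x > K)"
    then have "\<forall>\<^sub>F x in F. ereal (f x) \<le> ereal K"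
      by (simp add: not_frequently not_less)
    then have "Limsup F (\<lambda>x. ereal (f x)) \<le> ereal K"
      by (rule Limsup_bounded)
    then show False using inf by simp
  qed
next
  assume freq: "\<forall>K>0. \<exists>\<^sub>F x in F. f x > K"
  show "Limsup F (\<lambda>x. ereal (f x)) = \<infinity>"
  proof (rule ccontr)
    assume "Limsup F (\<lambda>x. ereal (f x)) \<noteq> \<infinity>"
    then obtain K where K: "Limsup F (\<lambda>x. ereal (f x)) < ereal K"
      by (metis less_PInf_Ex_of_nat ereal_less_PInfty)
    have "\<forall>\<^sub>F x in F. \<not> f x > max K 1"
      using Limsup_lessD[OF K] by (rule eventually_mono) simp
    moreover have "\<exists>\<^sub>F x in F. f x > max K 1"
      by (rule freq[rule_format]) (simp add: less_max_iff_disj)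
    ultimately show False
      unfolding frequently_def by blast
  qed
qed

lemma Liminf_eq_0_iff:
  fixes f :: "'a \<Rightarrow> real"
  assumes nonneg: "\<forall>\<^sub>F x in F. f x \<ge> 0"
  shows "Liminf F (\<lambda>x. ereal (f x)) = 0 \<longleftrightarrow> (\<forall>e>0. \<exists>\<^sub>F x in F. f x < e)"
proof
  assume 0: "Liminf F (\<lambda>x. ereal (f x)) = 0"
  show "\<forall>e>0. \<exists>\<^sub>F x in F. f x < e"
  proof (intro allI impI, rule ccontr)
    fix e :: real assume "e > 0" "\<not> (\<exists>\<^sub>F x in F. f x < e)"
    then have "\<forall>\<^sub>F x in F. ereal e \<le> ereal (f x)"
      by (simp add: not_frequently not_less)
    then have "ereal e \<le> Liminf F (\<lambda>x. ereal (f x))"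
      by (rule Liminf_bounded)
    then show False using 0 \<open>e > 0\<close> by simp
  qed
next
  assume freq: "\<forall>e>0. \<exists>\<^sub>F x in F. f x < e"
  show "Liminf F (\<lambda>x. ereal (f x)) = 0"
  proof (rule antisym)
    show "0 \<le> Liminf F (\<lambda>x. ereal (f x))"
      using nonneg by (intro Liminf_bounded) simp
    show "Liminf F (\<lambda>x. ereal (f x)) \<le> 0"
    proof (rule ccontr)
      assume "\<not> Liminf F (\<lambda>x. ereal (f x)) \<le> 0"
      then have "0 < Liminf F (\<lambda>x. ereal (f x))"
        by (simp only: not_le)
      from dense[OF this] obtain y where y: "0 < y" "y < Liminf F (\<lambda>x. ereal (f x))"
        by blast
      then obtain e where e: "y = ereal e" "e > 0"
        by (cases y) auto
      have "\<forall>\<^sub>F x in F. \<not> f x < e"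
        using less_LiminfD[OF y(2)] by (rule eventually_mono) (simp add: e)
      then show False
        using freq e by (auto simp: frequently_def)
    qed
  qed
qed

section \<open>The length scale\<close>

context solution_pair
begin

text \<open>
  Summing the Wronskian identity over the first sites and applying Cauchy-Schwarz: the two solutions
  cannot both be small, which is the limit point property.
\<close>

lemma norm_upto_product_lower_bound:
  assumes "L > 2"
  shows "L - 2 \<le> 2 * (norm_upto u1 L * norm_upto u2 L)"
proof -
  define M where "M = nat \<lfloor>L\<rfloor> - 1"
  have M: "L - 2 \<le> real M" "real (Suc M) \<le> L"
    using assms unfolding M_def by linarith+
  define K where "K = real (Suc M)"
  have K: "norm_upto u K = L2_set u {1..Suc M}" for u
    unfolding norm_upto_def K_def floor_of_nat nat_int of_int_of_nat_eq L2_set_def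
    by (simp del: sum.cl_ivl_Suc of_nat_Suc)
  have init: "L2_set u {1..M} \<le> norm_upto u K" for u
    unfolding K L2_set_def by (intro real_sqrt_le_mono sum_mono2) auto
  have shift: "L2_set (\<lambda>n. u (Suc n)) {1..M} \<le> norm_upto u K" for u
  proof -
    have "(\<Sum>n = 1..M. (u (Suc n))\<^sup>2) = (\<Sum>n = Suc 1..Suc M. (u n)\<^sup>2)"
      by (rule sum.shift_bounds_cl_Suc_ivl[symmetric])
    also have "\<dots> \<le> (\<Sum>n = 1..Suc M. (u n)\<^sup>2)"
      by (intro sum_mono2) auto
    finally show ?thesis
      unfolding K L2_set_def by (intro real_sqrt_le_mono)
  qed
  have "real M = (\<Sum>n = 1..M. u1 (Suc n) * u2 n - u1 n * u2 (Suc n))"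
    by (simp add: wronskian)
  also have "\<dots> \<le> (\<Sum>n = 1..M. \<bar>u1 (Suc n)\<bar> * \<bar>u2 n\<bar> + \<bar>u1 n\<bar> * \<bar>u2 (Suc n)\<bar>)"
  proof (rule sum_mono)
    fix n
    show "u1 (Suc n) * u2 n - u1 n * u2 (Suc n) \<le> \<bar>u1 (Suc n)\<bar> * \<bar>u2 n\<bar> + \<bar>u1 n\<bar> * \<bar>u2 (Suc n)\<bar>"
      unfolding abs_mult[symmetric] by linarith
  qed
  also have "\<dots> = (\<Sum>n = 1..M. \<bar>u1 (Suc n)\<bar> * \<bar>u2 n\<bar>) + (\<Sum>n = 1..M. \<bar>u1 n\<bar> * \<bar>u2 (Suc n)\<bar>)"
    by (rule sum.distrib)
  also have "\<dots> \<le> L2_set (\<lambda>n. u1 (Suc n)) {1..M} * L2_set u2 {1..M}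
      + L2_set u1 {1..M} * L2_set (\<lambda>n. u2 (Suc n)) {1..M}"
    by (intro add_mono L2_set_mult_ineq)
  also have "\<dots> \<le> norm_upto u1 K * norm_upto u2 K + norm_upto u1 K * norm_upto u2 K"
    by (intro add_mono mult_mono init shift L2_set_nonneg norm_upto_nonneg) (simp_all add: K_def)
  also have "\<dots> \<le> norm_upto u1 L * norm_upto u2 L + norm_upto u1 L * norm_upto u2 L"
    using M by (intro add_mono mult_mono norm_upto_mono norm_upto_nonneg) (simp_all add: K_def)
  finally show ?thesis
    using M by linarith
qed

lemma norm_upto_pos:
  assumes "L > 2"
  shows "norm_upto u1 L > 0" and "norm_upto u2 L > 0"
proof -
  have "norm_upto u1 L * norm_upto u2 L > 0"
    using norm_upto_product_lower_bound[OF assms] assms by linarith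
  then show "norm_upto u1 L > 0" "norm_upto u2 L > 0"
    using norm_upto_nonneg[of L u1] norm_upto_nonneg[of L u2] assms
    by (auto simp: zero_less_mult_iff)
qed

text \<open>
  The imaginary part of the energy that belongs to the length \<open>L\<close>.
\<close>

definition JL_scale :: "real \<Rightarrow> real" where
  "JL_scale L = inverse (norm_upto u1 L) * inverse (norm_upto u2 L)"

lemma JL_scale_at_right_0: "filterlim JL_scale (at_right 0) at_top"
proof -
  have "filterlim (\<lambda>L. norm_upto u1 L * norm_upto u2 L) at_top at_top"
    unfolding filterlim_at_top
  proof
    fix Z :: real
    show "\<forall>\<^sub>F L in at_top. Z \<le> norm_upto u1 L * norm_upto u2 L"
      using eventually_gt_at_top[of "max 2 (2 * Z + 2)"]
    proof eventually_elim
      case (elim L)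
      then show ?case
        using norm_upto_product_lower_bound[of L] by linarith
    qed
  qed
  then show ?thesis
    unfolding JL_scale_def[abs_def] inverse_mult_distrib[symmetric]
    by (rule filterlim_compose[OF filterlim_inverse_at_right_top])
qed

lemma JL_scale_continuous: "continuous_on {3..R} JL_scale"
proof -
  have cont: "continuous_on {3..R} (norm_upto u)" for u
    by (rule continuous_on_subset[OF continuous_on_norm_upto[of R]]) auto
  have "norm_upto u1 L \<noteq> 0" "norm_upto u2 L \<noteq> 0" if "L \<in> {3..R}" for L
    using norm_upto_pos[of L] that by auto
  then show ?thesis
    unfolding JL_scale_def[abs_def] by (intro continuous_on_mult continuous_on_inverse cont) blast+
qed

end

section \<open>The subordinacy criterion\<close>

theorem theorem2p2:
  fixes V :: "nat \<Rightarrow> real" and \<mu> :: "real measure" and E :: real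
    and u1 u2 :: "nat \<Rightarrow> real" and \<rho> :: "real \<Rightarrow> real"
  assumes "is_spectral_measure (schroedinger V) (schroedinger_domain V) delta1 \<mu>"
    and "eigen_equation V E u1" and "u1 0 = 0" and "u1 1 = 1"
    and "eigen_equation V E u2" and "u2 0 = 1" and "u2 1 = 0"
    and "hausdorff_dimension_function \<rho>"
  shows "Limsup (at_right 0)
           (\<lambda>\<epsilon>. ereal (\<epsilon> / \<rho> \<epsilon> * cmod (borel_transform \<mu> (Complex E \<epsilon>)))) = \<infinity>
     \<longleftrightarrow> Liminf at_top
           (\<lambda>L. ereal (\<rho> (inverse (norm_upto u1 L) * inverse (norm_upto u2 L))
                        * (norm_upto u1 L)\<^sup>2)) = 0"
proof -
  obtain P where res: "spectral_resolution (schroedinger V) (schroedinger_domain V) P"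
    and \<mu>: "\<mu> = scalar_measure P delta1"
    using assms(1) by (auto simp: is_spectral_measure_def)
  interpret schroedinger_resolution V P
    by unfold_locales (rule res)
  interpret solution_pair V E u1 u2
    by unfold_locales (use assms in auto)
  have \<rho>_pos: "\<rho> t > 0" if "t > 0" for t
    using assms(8) that by (simp add: hausdorff_dimension_function_def)
  define G where "G \<epsilon> = \<epsilon> / \<rho> \<epsilon> * cmod (borel_transform \<mu> (Complex E \<epsilon>))" for \<epsilon>
  define h where "h L = \<rho> (JL_scale L) * (norm_upto u1 L)\<^sup>2" for L
  have compare: "h L > 0" "G (JL_scale L) \<le> 11 / h L" "1 / h L \<le> 11 * G (JL_scale L)" if L: "L > 2" for L
  proof -
    define a b \<epsilon> where "a = norm_upto u1 L" and "b = norm_upto u2 L" and "\<epsilon> = JL_scale L"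
    have ab: "a > 0" "b > 0"
      using norm_upto_pos[OF L] by (simp_all add: a_def b_def)
    have \<epsilon>: "\<epsilon> = 1 / (a * b)" "\<epsilon> > 0"
      using ab by (simp_all add: \<epsilon>_def JL_scale_def a_def[symmetric] b_def[symmetric] divide_inverse)
    define F where "F = borel_transform \<mu> (Complex E \<epsilon>)"
    obtain w :: "nat \<Rightarrow> complex" where w: "w 0 = - 1" "w 1 = F"
      "\<And>n. n \<ge> 1 \<Longrightarrow> w (n - 1) + w (n + 1) + of_real (V n) * w n = Complex E \<epsilon> * w n"
      "\<And>N. \<epsilon> * (\<Sum>n = 1..N. (cmod (w n))\<^sup>2) \<le> cmod F"
      using weyl_solution[OF \<epsilon>(2), of E] unfolding F_def \<mu> by blast
    have "(cmod F * a - b)\<^sup>2 \<le> 9 * (cmod F * a * b)"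
      using Jitomirskaya_Last[of w \<epsilon> L] w \<epsilon> ab L unfolding a_def b_def by simp
    then have JL: "cmod F * a \<le> 11 * b" "b \<le> 11 * (cmod F * a)"
      using Jitomirskaya_Last_ratio ab by auto
    have h: "h L = \<rho> \<epsilon> * a\<^sup>2"
      by (simp add: h_def a_def \<epsilon>_def)
    then show "h L > 0"
      using \<rho>_pos[OF \<epsilon>(2)] ab by simp
    have "G (JL_scale L) = \<epsilon> / \<rho> \<epsilon> * cmod F"
      by (simp add: G_def F_def \<epsilon>_def)
    also have "\<dots> = (cmod F * a / b) / h L"
      using ab \<rho>_pos[OF \<epsilon>(2)] unfolding h by (subst (1) \<epsilon>(1)) (simp add: field_simps power2_eq_square)
    finally have G: "G (JL_scale L) = (cmod F * a / b) / h L" .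
    have "cmod F * a / b \<le> 11" "1 \<le> 11 * (cmod F * a / b)"
      using JL ab by (simp_all add: field_simps)
    then have "(cmod F * a / b) / h L \<le> 11 / h L" "1 / h L \<le> 11 * (cmod F * a / b) / h L"
      using \<open>h L > 0\<close> by (intro divide_right_mono; simp)+
    then show "G (JL_scale L) \<le> 11 / h L" "1 / h L \<le> 11 * G (JL_scale L)"
      unfolding G by (simp_all only: times_divide_eq_right)
  qed
  have "Limsup (at_right 0) (\<lambda>\<epsilon>. ereal (G \<epsilon>)) = \<infinity> \<longleftrightarrow> (\<forall>K>0. \<exists>\<^sub>F L in at_top. G (JL_scale L) > K)"
    unfolding Limsup_eq_PInfty_iff
    by (subst frequently_at_right_0_iff_at_top[OF JL_scale_continuous JL_scale_at_right_0]) simp_all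
  also have "\<dots> \<longleftrightarrow> (\<forall>e>0. \<exists>\<^sub>F L in at_top. h L < e)"
  proof (intro iffI allI impI)
    fix e :: real assume freq: "\<forall>K>0. \<exists>\<^sub>F L in at_top. G (JL_scale L) > K" and "e > 0"
    then have "\<exists>\<^sub>F L in at_top. G (JL_scale L) > 11 / e"
      by simp
    then show "\<exists>\<^sub>F L in at_top. h L < e"
    proof (rule frequently_rev_mp)
      show "\<forall>\<^sub>F L in at_top. 11 / e < G (JL_scale L) \<longrightarrow> h L < e"
        using eventually_gt_at_top[of 2]
      proof eventually_elim
        case (elim L)
        show ?case
        proof
          assume "11 / e < G (JL_scale L)"
          then have "11 / e < 11 / h L" using compare[OF elim] by linarith
          then show "h L < e" using compare(1)[OF elim] \<open>e > 0\<close> by (simp add: field_simps)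
        qed
      qed
    qed
  next
    fix K :: real assume freq: "\<forall>e>0. \<exists>\<^sub>F L in at_top. h L < e" and "K > 0"
    then have "\<exists>\<^sub>F L in at_top. h L < 1 / (11 * K)"
      by simp
    then show "\<exists>\<^sub>F L in at_top. G (JL_scale L) > K"
    proof (rule frequently_rev_mp)
      show "\<forall>\<^sub>F L in at_top. h L < 1 / (11 * K) \<longrightarrow> K < G (JL_scale L)"
        using eventually_gt_at_top[of 2]
      proof eventually_elim
        case (elim L)
        show ?case
        proof
          assume "h L < 1 / (11 * K)"
          then have "11 * K < 1 / h L" using compare(1)[OF elim] \<open>K > 0\<close> by (simp add: field_simps)
          then show "K < G (JL_scale L)" using compare(3)[OF elim] by linarith
        qed
      qed
    qed
  qed
  also have "\<dots> \<longleftrightarrow> Liminf at_top (\<lambda>L. ereal (h L)) = 0"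
    by (rule Liminf_eq_0_iff[symmetric])
       (rule eventually_mono[OF eventually_gt_at_top[of 2]], rule less_imp_le, rule compare(1))
  finally show ?thesis
    by (simp add: G_def h_def JL_scale_def)
qed

end
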